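(* Let $\operatorname{char}K\ne2$ and let $\mathbf J=\mathrm{Kan}(\mathbf P)$, generated as a Jordan superalgebra by $V_0,V_1,V_2,\bar1$. Then, with respect to this generating set, $$\mathrm{GKdim}\,\mathbf J=\underline{\mathrm{GKdim}}\,\mathbf J=2\log_\lambda2\approx3.3036,$$ where $\lambda\approx1.5214$ is the real root of $t^3-t-2$.
   Context: $H_\infty=\Lambda(x_i,y_i\mid i\ge0)$ is the Grassmann algebra over $K$ on odd generators with Poisson bracket $\{y_i,x_j\}=\delta_{ij}$, $\{x_i,x_j\}=\{y_i,y_j\}=0$; $\widetilde H$ is its completion by formal sums $c\cdot1+\sum\lambda_{\alpha,\beta}x^\alpha y^\beta$ over monomials with $\beta\ne0$ and (largest index in $\alpha$) $<$ (largest index in $\beta$). $V_i=\sum_{k\ge0}\big(\prod_{n=0}^{k-1}x_{i+3n}x_{i+3n+1}\big)y_{i+3k}$; $\mathbf P$ is the smallest unital subalgebra of $\widetilde H$ containing $V_0,V_1,V_2$ closed under product and bracket. $\mathrm{Kan}(\mathbf P)=\mathbf P\oplus\bar{\mathbf P}$ with $|\bar a|=1-|a|$ and $a\bullet b=ab$, $\bar a\bullet b=(-1)^{|b|}\overline{ab}$, $a\bullet\bar b=\overline{ab}$, $\bar a\bullet\bar b=(-1)^{|b|}\{a,b\}$. The growth function $\gamma(n)$ is the dimension of the span of all Jordan products of at most $n$ generators from $\{V_0,V_1,V_2,\bar1\}$; $\mathrm{GKdim}=\limsup\ln\gamma(n)/\ln n$, $\underline{\mathrm{GKdim}}=\liminf\ln\gamma(n)/\ln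 n$. *)

theory Defs
  imports Complex_Main "HOL-Library.Groups_Big_Fun" "HOL-Library.Function_Algebras"
    "HOL-Library.Extended_Real" "HOL-Library.Liminf_Limsup"
begin

text \<open>Odd generators of the Grassmann algebra are encoded by natural numbers:
  y_i is encoded as 2i and x_i as 2i+1.  A (normally ordered) monomial is the product of the
  generators in a finite set S of codes, taken in increasing order of codes.
  A formal sum (element of the completion) is its coefficient function on finite sets of codes;
  all our constructions vanish on infinite sets.\<close>

type_synonym 'k ser = "nat set \<Rightarrow> 'k"

definition ycode :: "nat \<Rightarrow> nat" where "ycode i = 2 * i"
definition xcode :: "nat \<Rightarrow> nat" where "xcode i = 2 * i + 1"

definition gen :: "nat \<Rightarrow> 'k::field ser" where
  "gen g = (\<lambda>S. if S = {g} then 1 else 0)"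

definition one_s :: "'k::field ser" where
  "one_s = (\<lambda>S. if S = {} then 1 else 0)"

definition xg :: "nat \<Rightarrow> 'k::field ser" where "xg i = gen (xcode i)"
definition yg :: "nat \<Rightarrow> 'k::field ser" where "yg i = gen (ycode i)"

text \<open>Sign of the product of two ordered monomials T, U (disjoint): parity of inversions.\<close>
definition sgnp :: "nat set \<Rightarrow> nat set \<Rightarrow> 'k::field" where
  "sgnp T U = (-1) ^ card {(t, u). t \<in> T \<and> u \<in> U \<and> u < t}"

definition mul :: "'k::field ser \<Rightarrow> 'k ser \<Rightarrow> 'k ser" where
  "mul f g = (\<lambda>S. \<Sum>T\<in>Pow S. sgnp T (S - T) * f T * g (S - T))"

definition smul :: "'k::field \<Rightarrow> 'k ser \<Rightarrow> 'k ser" where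
  "smul c f = (\<lambda>S. c * f S)"

definition deriv_s :: "nat \<Rightarrow> 'k::field ser \<Rightarrow> 'k ser" where
  "deriv_s g f = (\<lambda>S. if g \<notin> S then (-1) ^ card {s \<in> S. s < g} * f (insert g S) else 0)"

definition ev_part :: "'k::field ser \<Rightarrow> 'k ser" where
  "ev_part f = (\<lambda>S. if even (card S) then f S else 0)"
definition od_part :: "'k::field ser \<Rightarrow> 'k ser" where
  "od_part f = (\<lambda>S. if odd (card S) then f S else 0)"
definition par_sign :: "'k::field ser \<Rightarrow> 'k ser" where
  "par_sign f = (\<lambda>S. ev_part f S - od_part f S)"

text \<open>Poisson superbracket with {y_i,x_j} = delta_ij, {x_i,x_j} = {y_i,y_j} = 0, extended as an
  even super-biderivation; for homogeneous f:
  {f,g} = (-1)^(|f|+1) \<Sum>_i (d f/d x_i * d g/d y_i + d f/d y_i * d g/d x_i)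
  (left derivatives).  The sum over i is finite on the completion H~.\<close>
definition br_hom :: "nat \<Rightarrow> 'k::field ser \<Rightarrow> 'k ser \<Rightarrow> 'k ser" where
  "br_hom i f g = (\<lambda>S. mul (deriv_s (xcode i) f) (deriv_s (ycode i) g) S
                      + mul (deriv_s (ycode i) f) (deriv_s (xcode i) g) S)"

definition br :: "'k::field ser \<Rightarrow> 'k ser \<Rightarrow> 'k ser" where
  "br f g = (\<lambda>S. Sum_any (\<lambda>i. br_hom i (od_part f) g S - br_hom i (ev_part f) g S))"

text \<open>Completion H~: support in {empty} \<union> {monomials with beta nonempty and
  max index of alpha < max index of beta}; in codes: S = {} or Max S is even (a y).\<close>
definition Htilde :: "'k::field ser set" where
  "Htilde = {f. \<forall>S. f S \<noteq> 0 \<longrightarrow> finite S \<and> (S = {} \<or> even (Max S))}"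

fun Vterm :: "nat \<Rightarrow> nat \<Rightarrow> 'k::field ser" where
  "Vterm i 0 = yg i"
| "Vterm i (Suc k) = mul (mul (xg i) (xg (i + 1))) (Vterm (i + 3) k)"

definition V :: "nat \<Rightarrow> 'k::field ser" where
  "V i = (\<lambda>S. Sum_any (\<lambda>k. Vterm i k S))"

inductive_set Palg :: "'k::field ser set" where
  one: "one_s \<in> Palg"
| gen: "i < 3 \<Longrightarrow> V i \<in> Palg"
| add: "a \<in> Palg \<Longrightarrow> b \<in> Palg \<Longrightarrow> (\<lambda>S. a S + b S) \<in> Palg"
| smul: "a \<in> Palg \<Longrightarrow> smul c a \<in> Palg"
| mul: "a \<in> Palg \<Longrightarrow> b \<in> Palg \<Longrightarrow> mul a b \<in> Palg"
| br: "a \<in> Palg \<Longrightarrow> b \<in> Palg \<Longrightarrow> br a b \<in> Palg"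

text \<open>Kantor double: an element a + bbar is the function u with u (False,S) = a S, u (True,S) = b S.\<close>
type_synonym 'k kan = "bool \<times> nat set \<Rightarrow> 'k"

definition kpair :: "'k::field ser \<Rightarrow> 'k ser \<Rightarrow> 'k kan" where
  "kpair a b = (\<lambda>(t, S). if t then b S else a S)"
definition kfst :: "'k::field kan \<Rightarrow> 'k ser" where "kfst u = (\<lambda>S. u (False, S))"
definition ksnd :: "'k::field kan \<Rightarrow> 'k ser" where "ksnd u = (\<lambda>S. u (True, S))"

definition Kan :: "'k::field kan set" where
  "Kan = {kpair a b | a b. a \<in> Palg \<and> b \<in> Palg}"

text \<open>a.b = ab, abar.b = (-1)^|b| (ab)bar, a.bbar = (ab)bar, abar.bbar = (-1)^|b| {a,b},
  extended bilinearly.\<close>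
definition jprod :: "'k::field kan \<Rightarrow> 'k kan \<Rightarrow> 'k kan" where
  "jprod u v = kpair
     (\<lambda>S. mul (kfst u) (kfst v) S + br (ksnd u) (par_sign (ksnd v)) S)
     (\<lambda>S. mul (ksnd u) (par_sign (kfst v)) S + mul (kfst u) (ksnd v) S)"

definition Jgens :: "'k::field kan set" where
  "Jgens = {kpair (V 0) (\<lambda>_. 0), kpair (V 1) (\<lambda>_. 0), kpair (V 2) (\<lambda>_. 0), kpair (\<lambda>_. 0) one_s}"

inductive Jword :: "nat \<Rightarrow> 'k::field kan \<Rightarrow> bool" where
  base: "u \<in> Jgens \<Longrightarrow> Jword 1 u"
| prod: "Jword m u \<Longrightarrow> Jword k v \<Longrightarrow> Jword (m + k) (jprod u v)"

definition kscale :: "'k::field \<Rightarrow> 'k kan \<Rightarrow> 'k kan" where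
  "kscale c u = (\<lambda>x. c * u x)"

definition gamma :: "'k::field itself \<Rightarrow> nat \<Rightarrow> nat" where
  "gamma _ n = vector_space.dim (kscale :: 'k::field \<Rightarrow> 'k kan \<Rightarrow> 'k kan)
               {u. \<exists>m. 1 \<le> m \<and> m \<le> n \<and> Jword m u}"

definition GKdim :: "'k::field itself \<Rightarrow> ereal" where
  "GKdim _ = limsup (\<lambda>n. ereal (ln (real (gamma TYPE('k) n)) / ln (real n)))"

definition lower_GKdim :: "'k::field itself \<Rightarrow> ereal" where
  "lower_GKdim _ = liminf (\<lambda>n. ereal (ln (real (gamma TYPE('k) n)) / ln (real n)))"

end

theory Submission
  imports Defs
begin

text \<open>
  Give \<open>V\<^sub>n\<close> the weight \<open>lam ^ n\<close> and \<open>x\<^sub>i\<close> the weight \<open>- lam ^ i\<close>; the equation for \<open>lam\<close> makes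
  \<open>V\<^sub>n = y\<^sub>n + x\<^sub>n x\<^sub>n\<^sub>+\<^sub>1 V\<^sub>n\<^sub>+\<^sub>3\<close> homogeneous.

  Upper bound: the words \<open>x \<dots> x V\<^sub>n\<close> whose \<open>x\<close>-indices are at most \<open>n - 2\<close> and do not include both
  \<open>n - 3\<close> and \<open>n - 2\<close> span a space closed under the bracket, and since \<open>lam > 3 / 2\<close> their weights are
  at least a constant times \<open>lam ^ n\<close>.  By the Leibniz rule a Jordan word of length \<open>m\<close> is a combination
  of products of such words of total weight \<open>O(m)\<close>.  These only involve \<open>x\<^sub>i\<close> and \<open>V\<^sub>i\<close> with
  \<open>lam ^ i = O(m)\<close>, and \<open>N\<close> of each generate at most \<open>4 ^ N\<close> dimensions.

  Lower bound: \<open>V\<^sub>n\<^sub>+\<^sub>3\<close> is, up to sign, \<open>{V\<^sub>n, {V\<^sub>n, V\<^sub>n\<^sub>+\<^sub>1}}\<close>, and bracketing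
  \<open>x\<^sub>0 \<dots> x\<^sub>n\<^sub>-\<^sub>3 V\<^sub>n\<close> with \<open>x\<^sub>n\<^sub>-\<^sub>2 x\<^sub>n\<^sub>-\<^sub>1 V\<^sub>n\<^sub>+\<^sub>2\<close> yields \<open>x\<^sub>0 \<dots> x\<^sub>n\<^sub>+\<^sub>2 V\<^sub>n\<^sub>+\<^sub>5\<close>.  Bracketing with
  \<open>V\<^sub>i\<close> removes a factor \<open>x\<^sub>i\<close> and multiplication adds factors \<open>V\<^sub>j\<close>, so about \<open>4 ^ n\<close> words with distinct
  leading monomials arise within length \<open>O(lam ^ n)\<close>.
\<close>

section \<open>The Grassmann product and its derivations\<close>

notation mul (infixl "\<star>" 70)

section \<open>Signs of products of ordered monomials\<close>

lemma sgnp_empty [simp]: "sgnp {} U = 1" "sgnp T {} = 1"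
  by (simp_all add: sgnp_def)

lemma sgnp_square [simp]: "sgnp T U * sgnp T U = (1::'k::field)"
  by (simp add: sgnp_def flip: power_mult_distrib)

lemma finite_inversions:
  "finite T \<Longrightarrow> finite U \<Longrightarrow> finite {(t, u). t \<in> T \<and> u \<in> U \<and> u < (t::nat)}"
  by (rule finite_subset[of _ "T \<times> U"]) auto

lemma sgnp_Un_left:
  assumes "finite T" "finite U" "finite W" "T \<inter> U = {}"
  shows "sgnp (T \<union> U) W = (sgnp T W * sgnp U W :: 'k::field)"
proof -
  have "{(t, u). t \<in> T \<union> U \<and> u \<in> W \<and> u < t} =
    {(t, u). t \<in> T \<and> u \<in> W \<and> u < t} \<union> {(t, u). t \<in> U \<and> u \<in> W \<and> u < t}"
    by auto
  moreover have "{(t, u). t \<in> T \<and> u \<in> W \<and> u < t} \<inter> {(t, u). t \<in> U \<and> u \<in> W \<and> u < t} = {}"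
    using assms by auto
  ultimately show ?thesis
    using assms by (simp add: sgnp_def card_Un_disjoint finite_inversions power_add)
qed

lemma sgnp_Un_right:
  assumes "finite T" "finite U" "finite W" "U \<inter> W = {}"
  shows "sgnp T (U \<union> W) = (sgnp T U * sgnp T W :: 'k::field)"
proof -
  have "{(t, u). t \<in> T \<and> u \<in> U \<union> W \<and> u < t} =
    {(t, u). t \<in> T \<and> u \<in> U \<and> u < t} \<union> {(t, u). t \<in> T \<and> u \<in> W \<and> u < t}"
    by auto
  moreover have "{(t, u). t \<in> T \<and> u \<in> U \<and> u < t} \<inter> {(t, u). t \<in> T \<and> u \<in> W \<and> u < t} = {}"
    using assms by auto
  ultimately show ?thesis
    using assms by (simp add: sgnp_def card_Un_disjoint finite_inversions power_add)
qed

text \<open>Each pair in \<open>T \<times> U\<close> is an inversion for exactly one of the two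
  orders, so the two exponents add up to the product of the cardinalities.\<close>

lemma sgnp_swap:
  assumes "finite T" "finite U" "T \<inter> U = {}"
  shows "sgnp T U * sgnp U T = ((-1) ^ (card T * card U) :: 'k::field)"
proof -
  let ?A = "{(t, u). t \<in> T \<and> u \<in> U \<and> u < t}"
  let ?B = "{(t, u). t \<in> T \<and> u \<in> U \<and> t < u}"
  have "bij_betw prod.swap {(t, u). t \<in> U \<and> u \<in> T \<and> u < t} ?B"
    by (rule bij_betw_byWitness[where f' = prod.swap]) auto
  then have c: "card {(t, u). t \<in> U \<and> u \<in> T \<and> u < t} = card ?B"
    by (rule bij_betw_same_card)
  have "?A \<union> ?B = T \<times> U"
    using assms by auto
  moreover have "finite ?A" "finite ?B"
    using assms by (auto intro: finite_subset[of _ "T \<times> U"])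
  moreover have "?A \<inter> ?B = {}"
    by auto
  ultimately have "card ?A + card ?B = card (T \<times> U)"
    using card_Un_disjoint[of ?A ?B] by simp
  then show ?thesis
    unfolding sgnp_def c by (simp add: card_cartesian_product flip: power_add)
qed

lemma sgnp_commute:
  assumes "finite T" "finite U" "T \<inter> U = {}"
  shows "sgnp T U = ((-1) ^ (card T * card U) * sgnp U T :: 'k::field)"
  using arg_cong[OF sgnp_swap[OF assms], of "\<lambda>z. z * sgnp U T :: 'k"] by (simp add: mult.assoc)

section \<open>Algebra laws of the Grassmann product\<close>

lemma mul_infinite: "infinite S \<Longrightarrow> (f \<star> g) S = 0"
  by (simp add: mul_def finite_Pow_iff)

text \<open>Both sides sum over the ordered partitions of \<open>S\<close> into three blocks. By the
  splitting rules for \<open>sgnp\<close>, either sign is the product of the three signs of pairs of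
  blocks.\<close>

lemma mul_assoc: "(f \<star> g) \<star> h = f \<star> (g \<star> h)"
proof
  fix S :: "nat set"
  show "((f \<star> g) \<star> h) S = (f \<star> (g \<star> h)) S"
  proof (cases "finite S")
    case False
    then show ?thesis by (simp add: mul_infinite)
  next
    case True
    have fin: "finite T" if "T \<subseteq> S" for T
      using that True by (rule finite_subset)
    have "((f \<star> g) \<star> h) S = (\<Sum>A\<in>Pow S. \<Sum>T\<in>Pow A.
        sgnp A (S - A) * (sgnp T (A - T) * f T * g (A - T)) * h (S - A))"
      by (simp add: mul_def sum_distrib_left sum_distrib_right)
    also have "\<dots> = (\<Sum>(A, T)\<in>Sigma (Pow S) Pow.
        sgnp A (S - A) * (sgnp T (A - T) * f T * g (A - T)) * h (S - A))"
      by (rule sum.Sigma) (auto simp: True fin)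
    also have "\<dots> = (\<Sum>(T, B)\<in>Sigma (Pow S) (\<lambda>T. Pow (S - T)).
        sgnp T (S - T) * f T * (sgnp B (S - T - B) * g B * h (S - T - B)))"
    proof (rule sum.reindex_bij_witness[of _ "\<lambda>(T, B). (T \<union> B, T)" "\<lambda>(A, T). (T, A - T)"], goal_cases)
      case (5 a)
      then obtain A T where a: "a = (A, T)" "A \<subseteq> S" "T \<subseteq> A" by auto
      have 1: "S - T = (A - T) \<union> (S - A)" "S - T - (A - T) = S - A" and 2: "A = T \<union> (A - T)"
        using a by auto
      have "sgnp T (S - T) = (sgnp T (A - T) * sgnp T (S - A) :: 'a)"
        unfolding 1 using a by (intro sgnp_Un_right) (auto intro: fin)
      moreover have "sgnp A (S - A) = (sgnp T (S - A) * sgnp (A - T) (S - A) :: 'a)"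
        using a by (subst 2, intro sgnp_Un_left) (auto intro: fin)
      ultimately show ?case
        by (simp add: a 1(2) mult_ac)
    qed auto
    also have "\<dots> = (f \<star> (g \<star> h)) S"
      unfolding mul_def by (subst sum.Sigma[symmetric]) (auto simp: True fin sum_distrib_left)
    finally show ?thesis .
  qed
qed

lemma mul_add_left: "(f + g) \<star> h = f \<star> h + g \<star> h"
  by (rule ext) (simp add: mul_def algebra_simps sum.distrib)

lemma mul_add_right: "f \<star> (g + h) = f \<star> g + f \<star> h"
  by (rule ext) (simp add: mul_def algebra_simps sum.distrib)

lemma mul_smul_left: "smul c f \<star> g = smul c (f \<star> g)"
  by (rule ext) (simp add: mul_def smul_def sum_distrib_left mult_ac)

lemma mul_smul_right: "f \<star> smul c g = smul c (f \<star> g)"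
  by (rule ext) (simp add: mul_def smul_def sum_distrib_left mult_ac)

lemma mul_zero [simp]: "0 \<star> g = 0" "f \<star> 0 = 0"
  by (rule ext, simp add: mul_def)+

lemma mul_supportE:
  assumes "(f \<star> g) S \<noteq> 0"
  obtains T U where "finite S" "S = T \<union> U" "T \<inter> U = {}" "f T \<noteq> 0" "g U \<noteq> 0"
proof -
  have fin: "finite S"
    using assms mul_infinite by metis
  obtain T where "T \<in> Pow S" "sgnp T (S - T) * f T * g (S - T) \<noteq> 0"
    using assms unfolding mul_def by (rule sum.not_neutral_contains_not_neutral)
  then show thesis
    using that[OF fin, of T "S - T"] by auto
qed

interpretation ser: vector_space smul
  by standard (auto simp: smul_def algebra_simps)

lemma smul_zero [simp]: "smul c 0 = 0"
  by (rule ext) (simp add: smul_def)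

text \<open>Products vanish on infinite sets, because a sum over an infinite power set is 0 by
  convention; hence \<open>one_s\<close> is a unit only for series of this kind.\<close>

definition fin_supp :: "'k::field ser \<Rightarrow> bool" where
  "fin_supp f \<longleftrightarrow> (\<forall>S. f S \<noteq> 0 \<longrightarrow> finite S)"

lemma fin_supp_mul [simp]: "fin_supp (f \<star> g)"
  unfolding fin_supp_def by (meson mul_supportE)

lemma mul_one_left:
  assumes "fin_supp f"
  shows "one_s \<star> f = f"
proof
  fix S
  have "(one_s \<star> f) S = (\<Sum>T\<in>Pow S. if T = {} then f S else 0)"
    unfolding mul_def by (intro sum.cong) (auto simp: one_s_def)
  also have "\<dots> = f S"
    using assms by (cases "finite S") (auto simp: fin_supp_def finite_Pow_iff)
  finally show "(one_s \<star> f) S = f S" .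
qed

lemma mul_one_right:
  assumes "fin_supp f"
  shows "f \<star> one_s = f"
proof
  fix S
  have "(f \<star> one_s) S = (\<Sum>T\<in>Pow S. if T = S then f S else 0)"
    unfolding mul_def by (intro sum.cong) (auto simp: one_s_def)
  also have "\<dots> = f S"
    using assms by (cases "finite S") (auto simp: fin_supp_def finite_Pow_iff)
  finally show "(f \<star> one_s) S = f S" .
qed

text \<open>Only the parity of \<open>p\<close> matters. Taking a natural number lets the length of
  a word serve as its degree; the series 0 is homogeneous of every degree.\<close>

definition homog :: "nat \<Rightarrow> 'k::field ser \<Rightarrow> bool" where
  "homog p f \<longleftrightarrow> (\<forall>S. f S \<noteq> 0 \<longrightarrow> finite S \<and> (even (card S) \<longleftrightarrow> even p))"

lemma homog_fin_supp: "homog p f \<Longrightarrow> fin_supp f"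
  by (auto simp: homog_def fin_supp_def)

lemma homog_mul: "homog p f \<Longrightarrow> homog q g \<Longrightarrow> homog (p + q) (f \<star> g)"
  unfolding homog_def by (auto elim!: mul_supportE simp: card_Un_disjoint)

lemma homog_one [simp]: "homog 0 one_s"
  by (auto simp: homog_def one_s_def)

lemma homog_gen [simp]: "homog (Suc 0) (gen c)"
  by (auto simp: homog_def gen_def split: if_splits)

lemma mul_commute:
  assumes "homog p f" "homog q g"
  shows "f \<star> g = smul ((-1) ^ (p * q)) (g \<star> f)"
proof
  fix S
  show "(f \<star> g) S = smul ((-1) ^ (p * q)) (g \<star> f) S"
  proof (cases "finite S")
    case False
    then show ?thesis by (simp add: smul_def mul_infinite)
  next
    case True
    have "(f \<star> g) S = (\<Sum>T\<in>Pow S. (-1) ^ (p * q) * (sgnp T (S - T) * g T * f (S - T)))"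
      unfolding mul_def
    proof (rule sum.reindex_bij_witness[of _ "\<lambda>T. S - T" "\<lambda>T. S - T"], goal_cases)
      case (5 T)
      then have fin: "finite T" "finite (S - T)" and dc: "S - (S - T) = T"
        using True finite_subset by auto
      show ?case
      proof (cases "f T = 0 \<or> g (S - T) = 0")
        case True
        then show ?thesis using dc by auto
      next
        case False
        then have "even (card T) = even p" "even (card (S - T)) = even q"
          using assms by (auto simp: homog_def)
        then have "((-1) ^ (card T * card (S - T)) :: 'a) = (-1) ^ (p * q)"
          by (simp add: minus_one_power_iff)
        then show ?thesis
          using sgnp_commute[of T "S - T", where 'k='a] fin dc by (simp add: mult_ac)
      qed
    qed auto
    also have "\<dots> = smul ((-1) ^ (p * q)) (g \<star> f) S"
      by (simp add: smul_def mul_def sum_distrib_left)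
    finally show ?thesis .
  qed
qed

section \<open>Left derivatives\<close>

lemma deriv_add: "deriv_s c (f + g) = deriv_s c f + deriv_s c g"
  by (rule ext) (simp add: deriv_s_def algebra_simps)

lemma deriv_smul: "deriv_s c (smul a f) = smul a (deriv_s c f)"
  by (rule ext) (simp add: deriv_s_def smul_def)

lemma deriv_zero [simp]: "deriv_s c 0 = 0"
  by (rule ext) (simp add: deriv_s_def)

lemma deriv_eq_zero: "(\<And>S. f S \<noteq> 0 \<Longrightarrow> c \<notin> S) \<Longrightarrow> deriv_s c f = 0"
  by (rule ext) (auto simp: deriv_s_def)

lemma deriv_gen: "deriv_s c (gen d) = (if c = d then one_s else 0)"
  by (rule ext) (auto simp: deriv_s_def gen_def one_s_def)

lemma homog_deriv: "homog p f \<Longrightarrow> homog (Suc p) (deriv_s c f)"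
  by (auto simp: homog_def deriv_s_def split: if_splits)

text \<open>Rewrites the sign of a left derivative as the sign of moving the generator
  \<open>c\<close> into place, so that the multiplicativity of \<open>sgnp\<close> applies.\<close>

lemma deriv_sgnp: "c \<notin> S \<Longrightarrow> deriv_s c f S = sgnp {c} S * f (insert c S)"
proof -
  have "bij_betw (\<lambda>s. (c, s)) {s \<in> S. s < c} {(t, u). t \<in> {c} \<and> u \<in> S \<and> u < t}"
    by (rule bij_betw_byWitness[where f' = snd]) auto
  then show "c \<notin> S \<Longrightarrow> ?thesis"
    by (simp add: deriv_s_def sgnp_def bij_betw_same_card)
qed

lemma deriv_mul:
  assumes "homog p f"
  shows "deriv_s c (f \<star> g) = deriv_s c f \<star> g + smul ((-1) ^ p) (f \<star> deriv_s c g)"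
proof
  fix S
  show "deriv_s c (f \<star> g) S = (deriv_s c f \<star> g + smul ((-1) ^ p) (f \<star> deriv_s c g)) S"
  proof (cases "finite S")
    case False
    then show ?thesis by (simp add: smul_def mul_infinite deriv_s_def)
  next
    case True
    show ?thesis
    proof (cases "c \<in> S")
      case True
      define S0 where "S0 = S - {c}"
      have S: "S = insert c S0" "c \<notin> S0" "finite S0"
        using True \<open>finite S\<close> by (auto simp: S0_def)
      have fin: "finite T" if "T \<subseteq> S0" for T
        using that \<open>finite S0\<close> by (rule finite_subset)
      have split: "Pow S = insert c ` Pow S0 \<union> Pow S0"
        by (simp add: Pow_insert Un_commute S)
      have inj: "inj_on (insert c) (Pow S0)"
        using S(2) by (meson PowD inj_onI insert_ident subset_iff)
      have 1: "(deriv_s c f \<star> g) S = (\<Sum>T\<in>Pow S0. sgnp T (S - T) * deriv_s c f T * g (S - T))"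
        unfolding mul_def using S(3)
        by (intro sum.mono_neutral_right) (auto simp: S(1) deriv_s_def)
      have "(f \<star> deriv_s c g) S = (\<Sum>T\<in>insert c ` Pow S0. sgnp T (S - T) * f T * deriv_s c g (S - T))"
        unfolding mul_def
      proof (rule sum.mono_neutral_right)
        show "finite (Pow S)"
          using \<open>finite S\<close> by simp
        show "insert c ` Pow S0 \<subseteq> Pow S"
          by (auto simp: split)
        show "\<forall>T\<in>Pow S - insert c ` Pow S0. sgnp T (S - T) * f T * deriv_s c g (S - T) = 0"
        proof
          fix T assume "T \<in> Pow S - insert c ` Pow S0"
          then have "c \<in> S - T"
            using S(2) True unfolding split by auto
          then show "sgnp T (S - T) * f T * deriv_s c g (S - T) = 0"
            by (simp add: deriv_s_def)
        qed
      qed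
      also have "\<dots> = (\<Sum>T\<in>Pow S0. sgnp (insert c T) (S - insert c T) * f (insert c T) * deriv_s c g (S - insert c T))"
        by (simp add: sum.reindex[OF inj])
      finally have 2: "(f \<star> deriv_s c g) S = \<dots>" .
      \<comment> \<open>If \<open>c\<close> lies in \<open>S\<close>, the left side vanishes. On the
        right both products take \<open>c\<close> from each factor, and the two terms belonging to
        the same \<open>T\<close> cancel.\<close>
      have "sgnp T (S - T) * deriv_s c f T * g (S - T) +
          (-1) ^ p * (sgnp (insert c T) (S - insert c T) * f (insert c T) * deriv_s c g (S - insert c T)) = 0"
        if T: "T \<subseteq> S0" for T
      proof (cases "f (insert c T) = 0")
        case True
        moreover have "deriv_s c f T = 0"
          using True by (simp add: deriv_s_def)
        ultimately show ?thesis by simp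
      next
        case False
        let ?U = "S0 - T"
        have cT: "c \<notin> T" "c \<notin> ?U" and finT: "finite T" "finite ?U"
          using T S fin by auto
        have e: "S - T = {c} \<union> ?U" "S - insert c T = ?U" "insert c T = {c} \<union> T" "insert c ?U = {c} \<union> ?U"
          using T S by auto
        have 1: "sgnp T ({c} \<union> ?U) = (sgnp T {c} * sgnp T ?U :: 'a)"
          using cT finT by (intro sgnp_Un_right) auto
        have 2: "sgnp ({c} \<union> T) ?U = (sgnp {c} ?U * sgnp T ?U :: 'a)"
          using cT finT by (intro sgnp_Un_left) auto
        have 3: "deriv_s c f T = sgnp {c} T * f ({c} \<union> T)" "deriv_s c g ?U = sgnp {c} ?U * g ({c} \<union> ?U)"
          using cT deriv_sgnp[of c T f] deriv_sgnp[of c ?U g] by auto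
        have "even (Suc (card T)) = even p"
          using assms False finT cT by (auto simp: homog_def)
        then have "(-1) ^ p = - ((-1) ^ card T :: 'a)"
          by (auto simp: minus_one_power_iff)
        also have "(-1) ^ card T = (sgnp {c} T * sgnp T {c} :: 'a)"
          using sgnp_swap[of "{c}" T, where 'k='a] cT finT by simp
        finally have 4: "(-1) ^ p = - (sgnp {c} T * sgnp T {c} :: 'a)" .
        have 5: "sgnp {c} ?U * (sgnp {c} ?U * z) = z" for z :: 'a
          by (simp flip: mult.assoc)
        show ?thesis
          unfolding e(2) unfolding e(1,3) 1 2 3 4 by (simp add: mult_ac 5)
      qed
      then show ?thesis
        using True by (simp add: deriv_s_def[of c "f \<star> g"] smul_def 1 2 sum_distrib_left flip: sum.distrib)
    next
      case False
      have fin: "finite T" if "T \<subseteq> S" for T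
        using that \<open>finite S\<close> by (rule finite_subset)
      \<comment> \<open>If \<open>c\<close> is not in \<open>S\<close>, the factorizations of the
        monomial \<open>insert c S\<close> are sorted by the factor that receives \<open>c\<close>;
        the two groups give the two terms of the Leibniz rule.\<close>
      have split: "Pow (insert c S) = insert c ` Pow S \<union> Pow S"
        by (simp add: Pow_insert Un_commute)
      have inj: "inj_on (insert c) (Pow S)"
        using False by (auto simp: inj_on_def)
      have "deriv_s c (f \<star> g) S = sgnp {c} S * (f \<star> g) (insert c S)"
        using False by (rule deriv_sgnp)
      also have "(f \<star> g) (insert c S) =
          (\<Sum>T\<in>Pow S. sgnp (insert c T) (insert c S - insert c T) * f (insert c T) * g (insert c S - insert c T))
        + (\<Sum>T\<in>Pow S. sgnp T (insert c S - T) * f T * g (insert c S - T))"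
        unfolding mul_def split
        using False \<open>finite S\<close> by (subst sum.union_disjoint) (auto simp: sum.reindex[OF inj])
      also have "sgnp {c} S * \<dots> = (\<Sum>T\<in>Pow S. sgnp T (S - T) * deriv_s c f T * g (S - T))
         + (\<Sum>T\<in>Pow S. (-1) ^ p * (sgnp T (S - T) * f T * deriv_s c g (S - T)))"
      proof -
        have "sgnp {c} S * (sgnp (insert c T) (insert c S - insert c T) * f (insert c T) * g (insert c S - insert c T))
            = sgnp T (S - T) * deriv_s c f T * g (S - T)" if T: "T \<subseteq> S" for T
        proof -
          have e: "insert c S - insert c T = S - T" "S = T \<union> (S - T)" "insert c T = {c} \<union> T"
            using False T by auto
          have "sgnp {c} S = (sgnp {c} T * sgnp {c} (S - T) :: 'a)"
            using T by (subst e(2), intro sgnp_Un_right) (auto intro: fin)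
          moreover have "sgnp (insert c T) (S - T) = (sgnp {c} (S - T) * sgnp T (S - T) :: 'a)"
            using T False by (subst e(3), intro sgnp_Un_left) (auto intro: fin)
          moreover have "deriv_s c f T = sgnp {c} T * f (insert c T)"
            using T False by (intro deriv_sgnp) auto
          moreover have "sgnp {c} (S - T) * (sgnp {c} (S - T) * z) = z" for z :: 'a
            by (simp flip: mult.assoc)
          ultimately show ?thesis
            unfolding e(1) by (simp add: mult_ac)
        qed
        moreover have "sgnp {c} S * (sgnp T (insert c S - T) * f T * g (insert c S - T))
            = (-1) ^ p * (sgnp T (S - T) * f T * deriv_s c g (S - T))" if T: "T \<subseteq> S" for T
        proof (cases "f T = 0")
          case False': False
          have e: "insert c S - T = {c} \<union> (S - T)" "S = T \<union> (S - T)" "insert c (S - T) = insert c S - T"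
            using False T by auto
          have 1: "sgnp {c} S = (sgnp {c} T * sgnp {c} (S - T) :: 'a)"
            using T by (subst e(2), intro sgnp_Un_right) (auto intro: fin)
          have 2: "sgnp T (insert c S - T) = (sgnp T {c} * sgnp T (S - T) :: 'a)"
            using T False unfolding e(1) by (intro sgnp_Un_right) (auto intro: fin)
          have 3: "deriv_s c g (S - T) = sgnp {c} (S - T) * g (insert c S - T)"
            using T False unfolding e(3)[symmetric] by (intro deriv_sgnp) auto
          have "sgnp {c} T * sgnp T {c} = ((-1) ^ card T :: 'a)"
            using sgnp_swap[of "{c}" T] T False by (auto intro: fin)
          also have "\<dots> = (-1) ^ p"
            using assms False' by (auto simp: homog_def minus_one_power_iff)
          finally have 4: "(-1) ^ p = (sgnp {c} T * sgnp T {c} :: 'a)" ..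
          show ?thesis
            unfolding 1 2 3 4 by (simp add: mult_ac)
        qed simp
        ultimately show ?thesis
          unfolding distrib_left sum_distrib_left
          by (intro arg_cong2[of _ _ _ _ "(+)"] sum.cong) auto
      qed
      also have "\<dots> = (deriv_s c f \<star> g + smul ((-1) ^ p) (f \<star> deriv_s c g)) S"
        by (simp add: mul_def smul_def sum_distrib_left)
      finally show ?thesis .
    qed
  qed
qed

section \<open>The Poisson bracket\<close>

lemma sum_ser_apply: "(\<Sum>i\<in>A. F i) S = (\<Sum>i\<in>A. F i (S :: 'b) :: 'a::comm_monoid_add)"
  by (induction A rule: infinite_finite_induct) auto

lemma mul_sum_left: "(\<Sum>i\<in>A. F i) \<star> h = (\<Sum>i\<in>A. F i \<star> h)"
  unfolding fun_eq_iff mul_def sum_ser_apply sum_distrib_left sum_distrib_right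
  by (subst sum.swap) simp

lemma mul_sum_right: "h \<star> (\<Sum>i\<in>A. F i) = (\<Sum>i\<in>A. h \<star> F i)"
  unfolding fun_eq_iff mul_def sum_ser_apply sum_distrib_left
  by (subst sum.swap) simp

text \<open>The coefficient of a product at \<open>S\<close> only depends on coefficients at subsets
  of \<open>S\<close>. This allows an infinite sum inside a product to be replaced by a finite one
  valid below \<open>S\<close>.\<close>

lemma mul_cong:
  assumes "\<And>T. T \<subseteq> S \<Longrightarrow> f T = f' T" "\<And>T. T \<subseteq> S \<Longrightarrow> g T = g' T"
  shows "(f \<star> g) S = (f' \<star> g') S"
  unfolding mul_def using assms by (intro sum.cong) auto

text \<open>For tame series the sum over \<open>i\<close> in the bracket is finite at every monomial; unlike the completion,
  the class also contains the polynomials in the \<open>x\<^sub>i\<close>, as needed for the Leibniz rule.\<close>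

definition tame_above :: "nat \<Rightarrow> 'k::field ser \<Rightarrow> bool" where
  "tame_above M f \<longleftrightarrow> (\<forall>S. f S \<noteq> 0 \<longrightarrow> finite S \<and> (\<forall>i\<ge>M. xcode i \<in> S \<longrightarrow> (\<exists>c\<in>S. xcode i < c)))"

definition tame :: "'k::field ser \<Rightarrow> bool" where
  "tame f \<longleftrightarrow> (\<exists>M. tame_above M f)"

lemma tame_above_mono: "tame_above M f \<Longrightarrow> M \<le> N \<Longrightarrow> tame_above N f"
  by (auto simp: tame_above_def)

lemma tameE2:
  assumes "tame f" "tame g"
  obtains M where "tame_above M f" "tame_above M g"
  using assms unfolding tame_def by (meson tame_above_mono nat_le_linear)

lemma tame_fin_supp: "tame f \<Longrightarrow> fin_supp f"
  by (auto simp: tame_def tame_above_def fin_supp_def)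

lemma tame_zero [simp]: "tame 0"
  by (auto simp: tame_def tame_above_def)

lemma tame_above_mul: "tame_above M f \<Longrightarrow> tame_above M g \<Longrightarrow> tame_above M (f \<star> g)"
  unfolding tame_above_def by (auto elim!: mul_supportE) (meson UnCI)+

lemma tame_mul [simp]: "tame f \<Longrightarrow> tame g \<Longrightarrow> tame (f \<star> g)"
  by (meson tameE2 tame_above_mul tame_def)

lemma tame_add [simp]:
  assumes "tame f" "tame g"
  shows "tame (f + g)"
proof -
  obtain M where "tame_above M f" "tame_above M g"
    using assms by (rule tameE2)
  then have "tame_above M (f + g)"
    unfolding tame_above_def by (metis add.right_neutral plus_fun_apply)
  then show ?thesis by (auto simp: tame_def)
qed

lemma tame_smul [simp]: "tame f \<Longrightarrow> tame (smul c f)"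
  unfolding tame_def tame_above_def smul_def by (metis mult_zero_right)

lemma tame_one [simp]: "tame one_s"
  by (auto simp: tame_def tame_above_def one_s_def)

lemma tame_gen [simp]: "tame (gen c)"
proof -
  have "tame_above c (gen c)"
    by (auto simp: tame_above_def gen_def xcode_def)
  then show ?thesis by (auto simp: tame_def)
qed

lemma homog_parts:
  assumes "homog p f"
  shows "od_part f = (if odd p then f else 0)" "ev_part f = (if even p then f else 0)"
  using assms by (auto simp: fun_eq_iff od_part_def ev_part_def homog_def)

lemma homog_par_sign: "homog p f \<Longrightarrow> par_sign f = smul ((-1) ^ p) f"
  unfolding par_sign_def by (auto simp: homog_parts smul_def fun_eq_iff)

text \<open>A monomial of \<open>f\<close> or \<open>g\<close> that contains x_i with
  \<open>M \<le> i\<close> also contains a larger code, which cannot lie in \<open>S\<close>. So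
  both derivatives by x_i vanish on the subsets of \<open>S\<close>.\<close>

lemma br_hom_eq_zero:
  assumes "tame_above M f" "tame_above M g" "M \<le> i" "S \<subseteq> {..<2 * i}"
  shows "br_hom i f g S = 0"
proof -
  have zero: "deriv_s (xcode i) h T = 0" if h: "tame_above M h" "T \<subseteq> S" for h :: "'a ser" and T
  proof (rule ccontr)
    assume "deriv_s (xcode i) h T \<noteq> 0"
    then have "h (insert (xcode i) T) \<noteq> 0"
      by (auto simp: deriv_s_def split: if_splits)
    then obtain c where "c \<in> insert (xcode i) T" "xcode i < c"
      using h(1) assms(3) unfolding tame_above_def by (meson insertI1)
    then show False
      using h(2) assms(4) by (auto simp: xcode_def)
  qed
  have "(deriv_s (xcode i) f \<star> deriv_s (ycode i) g) S = (0 \<star> deriv_s (ycode i) g) S"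
    using zero[OF assms(1)] by (intro mul_cong) auto
  moreover have "(deriv_s (ycode i) f \<star> deriv_s (xcode i) g) S = (deriv_s (ycode i) f \<star> 0) S"
    using zero[OF assms(2)] by (intro mul_cong) auto
  ultimately show ?thesis
    by (simp add: br_hom_def)
qed

lemma tame_above_parts:
  "tame_above M f \<Longrightarrow> tame_above M (od_part f)" "tame_above M f \<Longrightarrow> tame_above M (ev_part f)"
  by (auto simp: tame_above_def od_part_def ev_part_def)

lemma br_infinite: "infinite S \<Longrightarrow> br f g S = 0"
  by (simp add: br_def br_hom_def mul_infinite)

lemma br_eq_sum:
  assumes "tame_above M f" "tame_above M g" "M \<le> N" "S \<subseteq> {..<2 * N}"
  shows "br f g S = (\<Sum>i<N. br_hom i (od_part f) g S - br_hom i (ev_part f) g S)"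
proof -
  have "br_hom i (od_part f) g S - br_hom i (ev_part f) g S = 0" if "N \<le> i" for i
  proof -
    have "M \<le> i" "S \<subseteq> {..<2 * i}"
      using assms(3,4) that by (auto simp: subset_iff)
    then show ?thesis
      using assms(1,2) by (simp add: br_hom_eq_zero[of M] tame_above_parts)
  qed
  then show ?thesis
    unfolding br_def by (intro Sum_any.expand_superset) (auto simp: not_less[symmetric])
qed

lemma br_eq_sum_homog:
  assumes "homog p f" "tame_above M f" "tame_above M g" "M \<le> N" "S \<subseteq> {..<2 * N}"
  shows "br f g S = (\<Sum>i<N. smul (- ((-1) ^ p)) (br_hom i f g)) S"
  unfolding br_eq_sum[OF assms(2-5)] homog_parts[OF assms(1)] sum_ser_apply
  by (intro sum.cong) (auto simp: smul_def br_hom_def)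

lemma finite_codes_bound:
  assumes "finite (S :: nat set)"
  obtains N where "M \<le> N" "S \<subseteq> {..<2 * N}"
proof -
  obtain K where "S \<subseteq> {..<K}"
    using assms finite_nat_bounded by blast
  moreover have "{..<K} \<subseteq> {..<2 * max M K}"
    by auto
  ultimately have "M \<le> max M K" "S \<subseteq> {..<2 * max M K}"
    by auto
  then show thesis by (rule that)
qed

lemma br_hom_fun: "br_hom i f g =
  deriv_s (xcode i) f \<star> deriv_s (ycode i) g + deriv_s (ycode i) f \<star> deriv_s (xcode i) g"
  by (simp add: br_hom_def fun_eq_iff)

lemma smul_apply: "smul a f S = a * f S"
  by (simp add: smul_def)

lemma smul_smul: "smul a (smul b f) = smul (a * b) f"
  by (rule ext) (simp add: smul_def)

lemma smul_add: "smul a (f + g) = smul a f + smul a g"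
  by (rule ext) (simp add: smul_def algebra_simps)

lemma smul_one [simp]: "smul 1 f = f"
  by (rule ext) (simp add: smul_def)

lemma smul_0_left [simp]: "smul 0 f = 0"
  by (rule ext) (simp add: smul_def)

lemma smul_sum: "smul a (\<Sum>i\<in>A. F i) = (\<Sum>i\<in>A. smul a (F i))"
  by (rule ext) (simp add: smul_def sum_ser_apply sum_distrib_left)

section \<open>Leibniz rules and symmetry of the bracket\<close>

lemma br_hom_mul_right:
  assumes "homog p f" "homog q g"
  shows "br_hom i f (g \<star> h) = br_hom i f g \<star> h + smul ((-1) ^ (p * q)) (g \<star> br_hom i f h)"
proof -
  have "deriv_s c f \<star> deriv_s d (g \<star> h) =
      (deriv_s c f \<star> deriv_s d g) \<star> h + smul ((-1) ^ (p * q)) (g \<star> (deriv_s c f \<star> deriv_s d h))" for c d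
  proof -
    \<comment> \<open>The derivative of \<open>f\<close> has degree \<open>Suc p\<close>; the extra
      sign \<open>(-1) ^ q\<close> from moving it past \<open>g\<close> cancels the one from
      differentiating past \<open>g\<close>.\<close>
    have "deriv_s c f \<star> g = smul ((-1) ^ (Suc p * q)) (g \<star> deriv_s c f)"
      using assms by (intro mul_commute homog_deriv)
    then have "deriv_s c f \<star> (g \<star> deriv_s d h) =
        smul ((-1) ^ (Suc p * q)) (g \<star> (deriv_s c f \<star> deriv_s d h))"
      by (metis mul_assoc mul_smul_left)
    then show ?thesis
      by (simp add: deriv_mul[OF assms(2)] mul_add_right mul_smul_right smul_smul mul_assoc
        power_add flip: power_mult_distrib mult.assoc)
  qed
  then show ?thesis
    by (simp add: br_hom_fun mul_add_left mul_add_right smul_add)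
qed

lemma br_hom_mul_left:
  assumes "homog p f" "homog r h" "homog q g"
  shows "br_hom i (f \<star> h) g = smul ((-1) ^ p) (f \<star> br_hom i h g)
    + smul ((-1) ^ (r * Suc q)) (br_hom i f g \<star> h)"
proof -
  have "deriv_s c (f \<star> h) \<star> deriv_s d g = smul ((-1) ^ p) (f \<star> (deriv_s c h \<star> deriv_s d g))
      + smul ((-1) ^ (r * Suc q)) ((deriv_s c f \<star> deriv_s d g) \<star> h)" for c d
  proof -
    have "h \<star> deriv_s d g = smul ((-1) ^ (r * Suc q)) (deriv_s d g \<star> h)"
      using assms by (intro mul_commute homog_deriv)
    then show ?thesis
      by (simp add: deriv_mul[OF assms(1)] mul_add_left mul_smul_left mul_smul_right mul_assoc add.commute)
  qed
  then show ?thesis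
    by (simp add: br_hom_fun mul_add_left mul_add_right smul_add)
qed

lemma br_hom_commute:
  assumes "homog p f" "homog q g"
  shows "br_hom i g f = smul ((-1) ^ (Suc p * Suc q)) (br_hom i f g)"
proof -
  have "deriv_s c g \<star> deriv_s d f = smul ((-1) ^ (Suc p * Suc q)) (deriv_s d f \<star> deriv_s c g)" for c d
    using mul_commute[OF homog_deriv homog_deriv, OF assms(2,1)] by (simp add: mult.commute)
  then show ?thesis
    by (simp add: br_hom_fun smul_add add.commute)
qed

lemma br_mul_right:
  assumes "homog p f" "homog q g" "tame f" "tame g" "tame h"
  shows "br f (g \<star> h) = br f g \<star> h + smul ((-1) ^ (p * q)) (g \<star> br f h)"
proof
  fix S
  show "br f (g \<star> h) S = (br f g \<star> h + smul ((-1) ^ (p * q)) (g \<star> br f h)) S"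
  proof (cases "finite S")
    case False
    then show ?thesis by (simp add: br_infinite mul_infinite smul_def)
  next
    case True
    obtain M1 M2 where "tame_above M1 f" "tame_above M1 g" "tame_above M2 h"
      using assms by (meson tameE2)
    then obtain M where M: "tame_above M f" "tame_above M g" "tame_above M h"
      by (meson tame_above_mono nat_le_linear)
    obtain N where N: "M \<le> N" "S \<subseteq> {..<2 * N}"
      using True by (rule finite_codes_bound)
    let ?b = "\<lambda>g. (\<Sum>i<N. smul (- ((-1) ^ p)) (br_hom i f g))"
    \<comment> \<open>One cutoff \<open>N\<close> works for all subsets of \<open>S\<close> at once,
      so \<open>mul_cong\<close> can exchange the bracket with its finite sum inside
      products.\<close>
    have eq: "br f g' T = ?b g' T" if "T \<subseteq> S" "tame_above M g'" for T g'
      using assms M N that by (intro br_eq_sum_homog) auto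
    have "br f (g \<star> h) S = ?b (g \<star> h) S"
      using M by (intro eq tame_above_mul) auto
    also have "?b (g \<star> h) = ?b g \<star> h + smul ((-1) ^ (p * q)) (g \<star> ?b h)"
      unfolding br_hom_mul_right[OF assms(1,2)] mul_sum_left mul_sum_right smul_sum smul_add
        mul_smul_left mul_smul_right smul_smul sum.distrib by (simp only: mult.commute)
    also have "\<dots> S = (?b g \<star> h) S + (-1) ^ (p * q) * (g \<star> ?b h) S"
      by (simp only: plus_fun_apply smul_apply)
    also have "(?b g \<star> h) S = (br f g \<star> h) S"
      by (intro mul_cong) (auto simp only: eq M)
    also have "(g \<star> ?b h) S = (g \<star> br f h) S"
      by (intro mul_cong) (auto simp only: eq M)
    finally show ?thesis
      by (simp add: smul_def)
  qed
qed

lemma br_mul_left: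
  assumes "homog p f" "homog r h" "homog q g" "tame f" "tame h" "tame g"
  shows "br (f \<star> h) g = f \<star> br h g + smul ((-1) ^ (r * q)) (br f g \<star> h)"
proof
  fix S
  show "br (f \<star> h) g S = (f \<star> br h g + smul ((-1) ^ (r * q)) (br f g \<star> h)) S"
  proof (cases "finite S")
    case False
    then show ?thesis by (simp add: br_infinite mul_infinite smul_def)
  next
    case True
    obtain M1 M2 where "tame_above M1 f" "tame_above M1 g" "tame_above M2 h"
      using assms by (meson tameE2)
    then obtain M where M: "tame_above M f" "tame_above M g" "tame_above M h"
      by (meson tame_above_mono nat_le_linear)
    obtain N where N: "M \<le> N" "S \<subseteq> {..<2 * N}"
      using True by (rule finite_codes_bound)
    let ?b = "\<lambda>p f. (\<Sum>i<N. smul (- ((-1) ^ p)) (br_hom i f g))"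
    have eq: "br f' g T = ?b p' f' T" if "T \<subseteq> S" "tame_above M f'" "homog p' f'" for T f' p'
      using M N that by (intro br_eq_sum_homog) auto
    \<comment> \<open>The prefactor of the bracket depends on the parity of its first argument,
      which is \<open>p + r\<close> for the product but \<open>r\<close> and \<open>p\<close> for
      the factors.\<close>
    have s: "- ((-1) ^ (p + r)) * (-1) ^ p = (- ((-1) ^ r) :: 'a)"
      "- ((-1) ^ (p + r)) * (-1) ^ (r * Suc q) = ((-1) ^ (r * q) * - ((-1) ^ p) :: 'a)"
      by (auto simp: minus_one_power_iff)
    have "br (f \<star> h) g S = ?b (p + r) (f \<star> h) S"
      using M assms by (intro eq tame_above_mul homog_mul) auto
    also have "?b (p + r) (f \<star> h) = f \<star> ?b r h + smul ((-1) ^ (r * q)) (?b p f \<star> h)"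
      unfolding br_hom_mul_left[OF assms(1-3)] mul_sum_left mul_sum_right smul_sum smul_add
        mul_smul_left mul_smul_right smul_smul sum.distrib s ..
    also have "\<dots> S = (f \<star> ?b r h) S + (-1) ^ (r * q) * (?b p f \<star> h) S"
      by (simp only: plus_fun_apply smul_apply)
    also have "(f \<star> ?b r h) S = (f \<star> br h g) S"
      by (intro mul_cong) (auto simp only: eq[OF _ M(3) assms(2)])
    also have "(?b p f \<star> h) S = (br f g \<star> h) S"
      by (intro mul_cong) (auto simp only: eq[OF _ M(1) assms(1)])
    finally show ?thesis
      by (simp add: smul_def)
  qed
qed

lemma br_commute:
  assumes "homog p f" "homog q g" "tame f" "tame g"
  shows "br g f = smul (- ((-1) ^ (p * q))) (br f g)"
proof
  fix S
  show "br g f S = smul (- ((-1) ^ (p * q))) (br f g) S"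
  proof (cases "finite S")
    case False
    then show ?thesis by (simp add: br_infinite smul_def)
  next
    case True
    obtain M where M: "tame_above M f" "tame_above M g"
      using assms(3,4) by (rule tameE2)
    obtain N where N: "M \<le> N" "S \<subseteq> {..<2 * N}"
      using True by (rule finite_codes_bound)
    have s: "- ((-1) ^ q) * (-1) ^ (Suc p * Suc q) = (- ((-1) ^ (p * q)) * - ((-1) ^ p) :: 'a)"
      by (auto simp: minus_one_power_iff)
    have "(\<Sum>i<N. smul (- ((-1) ^ q)) (br_hom i g f))
        = smul (- ((-1) ^ (p * q))) (\<Sum>i<N. smul (- ((-1) ^ p)) (br_hom i f g))"
      unfolding br_hom_commute[OF assms(1,2)] smul_sum smul_smul s ..
    then show ?thesis
      unfolding br_eq_sum_homog[OF assms(2) M(2,1) N] smul_def[of _ "br f g"]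
        br_eq_sum_homog[OF assms(1) M N] by (simp add: smul_def)
  qed
qed

section \<open>Bilinearity, and brackets with generators\<close>

lemma deriv_one [simp]: "deriv_s c one_s = 0"
  by (rule deriv_eq_zero) (auto simp: one_s_def split: if_splits)

lemma br_one_left [simp]: "br one_s g = 0"
  by (intro ext) (simp add: br_def br_hom_fun homog_parts[OF homog_one])

lemma br_one_right [simp]: "br f one_s = 0"
  by (intro ext) (simp add: br_def br_hom_fun)

lemma br_hom_add:
  "br_hom i (f + f') g = br_hom i f g + br_hom i f' g"
  "br_hom i f (g + g') = br_hom i f g + br_hom i f g'"
  by (simp_all add: br_hom_fun deriv_add mul_add_left mul_add_right)

lemma br_hom_smul:
  "br_hom i (smul a f) g = smul a (br_hom i f g)"
  "br_hom i f (smul a g) = smul a (br_hom i f g)"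
  by (simp_all add: br_hom_fun deriv_smul mul_smul_left mul_smul_right smul_add)

lemma parts_linear:
  "od_part (f + g) = od_part f + od_part g" "ev_part (f + g) = ev_part f + ev_part g"
  "od_part (smul a f) = smul a (od_part f)" "ev_part (smul a f) = smul a (ev_part f)"
  by (auto simp: od_part_def ev_part_def smul_def)

lemma br_add_left:
  assumes "tame f" "tame f'" "tame g"
  shows "br (f + f') g = br f g + br f' g"
proof
  fix S
  show "br (f + f') g S = (br f g + br f' g) S"
  proof (cases "finite S")
    case False
    then show ?thesis by (simp add: br_infinite)
  next
    case True
    obtain M1 M2 M3 where "tame_above M1 f" "tame_above M1 f'" "tame_above M2 g" "tame_above M3 (f + f')"
      using assms by (meson tameE2 tame_add)
    then obtain M where M: "tame_above M f" "tame_above M f'" "tame_above M g" "tame_above M (f + f')"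
      by (meson tame_above_mono nat_le_linear)
    obtain N where N: "M \<le> N" "S \<subseteq> {..<2 * N}"
      using True by (rule finite_codes_bound)
    have "br (f + f') g S = br f g S + br f' g S"
      unfolding br_eq_sum[OF M(4,3) N] br_eq_sum[OF M(1,3) N] br_eq_sum[OF M(2,3) N]
      by (simp add: parts_linear br_hom_add sum.distrib sum_subtractf)
    then show ?thesis by simp
  qed
qed

lemma br_add_right:
  assumes "tame f" "tame g" "tame g'"
  shows "br f (g + g') = br f g + br f g'"
proof
  fix S
  show "br f (g + g') S = (br f g + br f g') S"
  proof (cases "finite S")
    case False
    then show ?thesis by (simp add: br_infinite)
  next
    case True
    obtain M1 M2 M3 where "tame_above M1 g" "tame_above M1 g'" "tame_above M2 f" "tame_above M3 (g + g')"
      using assms by (meson tameE2 tame_add)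
    then obtain M where M: "tame_above M g" "tame_above M g'" "tame_above M f" "tame_above M (g + g')"
      by (meson tame_above_mono nat_le_linear)
    obtain N where N: "M \<le> N" "S \<subseteq> {..<2 * N}"
      using True by (rule finite_codes_bound)
    have "br f (g + g') S = br f g S + br f g' S"
      unfolding br_eq_sum[OF M(3,4) N] br_eq_sum[OF M(3,1) N] br_eq_sum[OF M(3,2) N]
      by (simp add: parts_linear br_hom_add sum.distrib sum_subtractf)
    then show ?thesis by simp
  qed
qed

lemma br_smul_left:
  assumes "tame f" "tame g"
  shows "br (smul a f) g = smul a (br f g)"
proof
  fix S
  show "br (smul a f) g S = smul a (br f g) S"
  proof (cases "finite S")
    case False
    then show ?thesis by (simp add: br_infinite smul_def)
  next
    case True
    obtain M1 M2 where "tame_above M1 f" "tame_above M1 g" "tame_above M2 (smul a f)"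
      using assms by (meson tameE2 tame_smul)
    then obtain M where M: "tame_above M f" "tame_above M g" "tame_above M (smul a f)"
      by (meson tame_above_mono nat_le_linear)
    obtain N where N: "M \<le> N" "S \<subseteq> {..<2 * N}"
      using True by (rule finite_codes_bound)
    show ?thesis
      unfolding br_eq_sum[OF M(3,2) N] smul_apply[of a "br f g"] br_eq_sum[OF M(1,2) N]
      by (simp add: parts_linear br_hom_smul smul_apply sum_distrib_left right_diff_distrib)
  qed
qed

lemma br_smul_right:
  assumes "tame f" "tame g"
  shows "br f (smul a g) = smul a (br f g)"
proof
  fix S
  show "br f (smul a g) S = smul a (br f g) S"
  proof (cases "finite S")
    case False
    then show ?thesis by (simp add: br_infinite smul_def)
  next
    case True
    obtain M1 M2 where "tame_above M1 f" "tame_above M1 g" "tame_above M2 (smul a g)"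
      using assms by (meson tameE2 tame_smul)
    then obtain M where M: "tame_above M f" "tame_above M g" "tame_above M (smul a g)"
      by (meson tame_above_mono nat_le_linear)
    obtain N where N: "M \<le> N" "S \<subseteq> {..<2 * N}"
      using True by (rule finite_codes_bound)
    show ?thesis
      unfolding br_eq_sum[OF M(1,3) N] smul_apply[of a "br f g"] br_eq_sum[OF M(1,2) N]
      by (simp add: parts_linear br_hom_smul smul_apply sum_distrib_left right_diff_distrib)
  qed
qed

lemma fin_supp_deriv: "fin_supp f \<Longrightarrow> fin_supp (deriv_s c f)"
  by (auto simp: fin_supp_def deriv_s_def split: if_splits)

text \<open>Only the index \<open>i\<close> contributes to the sum, and there the derivative of the
  generator is \<open>one_s\<close>; the sign in the bracket is +1 because generators are
  odd.\<close>

lemma br_gen: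
  assumes "tame g"
  shows "br (xg i) g = deriv_s (ycode i) g" "br (yg i) g = deriv_s (xcode i) g"
proof -
  have codes: "xcode a \<noteq> ycode b" "xcode a = xcode b \<longleftrightarrow> a = b" "ycode a = ycode b \<longleftrightarrow> a = b" for a b
    by (simp_all add: xcode_def ycode_def) presburger
  have hom: "br_hom j (xg i) g = (if j = i then deriv_s (ycode i) g else 0)"
    "br_hom j (yg i) g = (if j = i then deriv_s (xcode i) g else 0)" for j
    using assms codes codes(1)[THEN not_sym]
    by (auto simp: br_hom_fun xg_def yg_def deriv_gen mul_one_left fin_supp_deriv tame_fin_supp)
  have "br (gen c) g S = (\<Sum>j\<in>{i}. br_hom j (gen c) g S)"
    if "\<And>j. j \<noteq> i \<Longrightarrow> br_hom j (gen c) g S = 0" for c S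
    unfolding br_def homog_parts[OF homog_gen]
    using that by (subst Sum_any.expand_superset[of "{i}"]) (auto simp: br_hom_fun)
  then show "br (xg i) g = deriv_s (ycode i) g" "br (yg i) g = deriv_s (xcode i) g"
    using hom by (auto simp: fun_eq_iff xg_def yg_def)
qed

section \<open>The elements \<open>V\<close> and words in them\<close>

text \<open>The code \<open>2 * (i + 3 * k)\<close> is that of the final factor y. Being the largest
  code of the monomial, it makes the sum over \<open>k\<close> finite at each monomial and makes V_i
  tame.\<close>

lemma Vterm_support:
  "Vterm i k S \<noteq> 0 \<Longrightarrow>
    finite S \<and> S \<subseteq> {2 * i..2 * (i + 3 * k)} \<and> 2 * (i + 3 * k) \<in> S \<and> odd (card S)"
proof (induction k arbitrary: i S)
  case 0
  then show ?case by (auto simp: yg_def gen_def ycode_def split: if_splits)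
next
  case (Suc k)
  from Suc.prems obtain T W where S: "S = T \<union> W" "T \<inter> W = {}" "(xg i \<star> xg (i + 1)) T \<noteq> (0::'a)"
    and W: "Vterm (i + 3) k W \<noteq> (0::'a)"
    unfolding Vterm.simps by (rule mul_supportE) blast
  have T: "T = {2 * i + 1, 2 * i + 3}"
    using S(3) by (auto elim!: mul_supportE simp: xg_def gen_def xcode_def split: if_splits)
  have "finite W" "odd (card W)"
    "W \<subseteq> {2 * (i + 3)..2 * (i + 3 + 3 * k)}" "2 * (i + 3 + 3 * k) \<in> W"
    using Suc.IH[OF W] by auto
  moreover have "card S = 2 + card W"
    using S(2) T \<open>finite W\<close> by (simp add: S(1) card_Un_disjoint)
  ultimately show ?case
    by (auto simp: S(1) T algebra_simps)
qed

lemma V_supportE: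
  assumes "V i S \<noteq> (0::'a::field)"
  obtains k where "Vterm i k S \<noteq> (0::'a)"
proof -
  have "V i S = (0::'a)" if "\<And>k. Vterm i k S = (0::'a)"
    by (simp add: V_def that)
  then show thesis using assms that by blast
qed

lemma V_eq_sum:
  assumes "S \<subseteq> {..<N}"
  shows "V i S = (\<Sum>k<N. Vterm i k S)"
proof -
  have "k < N" if "Vterm i k S \<noteq> (0::'a)" for k
    using Vterm_support[OF that] assms by force
  then show ?thesis
    unfolding V_def by (intro Sum_any.expand_superset) auto
qed

text \<open>On subsets of a finite set both series for V are finite sums, so splitting off the term
  \<open>k = 0\<close> and shifting the index is legitimate monomial by monomial.\<close>

lemma V_rec: "V i = (yg i + (xg i \<star> xg (i + 1)) \<star> V (i + 3) :: 'a::field ser)"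
proof
  fix S
  show "V i S = (yg i + (xg i \<star> xg (i + 1)) \<star> V (i + 3) :: 'a ser) S"
  proof (cases "finite S")
    case False
    have "V i S = (0::'a)"
      using False Vterm_support V_supportE by metis
    moreover have "yg i S = (0::'a)"
      using False by (auto simp: yg_def gen_def)
    ultimately show ?thesis
      using False by (simp add: mul_infinite)
  next
    case True
    then obtain N where N: "S \<subseteq> {..<N}"
      using finite_nat_bounded by blast
    have "V i S = (\<Sum>k<Suc N. Vterm i k S)"
      using N by (intro V_eq_sum) auto
    also have "\<dots> = yg i S + ((xg i \<star> xg (i + 1)) \<star> (\<Sum>k<N. Vterm (i + 3) k)) S"
      by (simp add: sum.lessThan_Suc_shift mul_sum_right sum_ser_apply del: sum.lessThan_Suc)
    also have "((xg i \<star> xg (i + 1)) \<star> (\<Sum>k<N. Vterm (i + 3) k)) S = ((xg i \<star> xg (i + 1)) \<star> V (i + 3)) S"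
    proof (rule mul_cong)
      fix T assume "T \<subseteq> S"
      then have "T \<subseteq> {..<N}"
        using N by auto
      then show "(\<Sum>k<N. Vterm (i + 3) k) T = V (i + 3) T"
        by (simp add: sum_ser_apply V_eq_sum)
    qed simp
    finally show ?thesis by simp
  qed
qed

lemma homog_V [simp]: "homog (Suc 0) (V i)"
  unfolding homog_def by (auto elim!: V_supportE dest!: Vterm_support)

lemma V_support_ge: "V i S \<noteq> 0 \<Longrightarrow> c \<in> S \<Longrightarrow> 2 * i \<le> c"
  by (erule V_supportE) (use Vterm_support in fastforce)

lemma tame_V [simp]: "tame (V i)"
proof -
  have "\<exists>c\<in>S. xcode j < c" if V: "V i S \<noteq> (0::'a)" and j: "xcode j \<in> S" for S j
  proof -
    obtain k where "S \<subseteq> {2 * i..2 * (i + 3 * k)}" "2 * (i + 3 * k) \<in> S"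
      using V by (auto elim!: V_supportE dest!: Vterm_support)
    moreover have "xcode j \<noteq> 2 * (i + 3 * k)"
      unfolding xcode_def by presburger
    ultimately show ?thesis
      using j by (intro bexI[of _ "2 * (i + 3 * k)"]) auto
  qed
  then have "tame_above 0 (V i :: 'a ser)"
    using homog_fin_supp[OF homog_V[of i]] by (auto simp: tame_above_def fin_supp_def)
  then show ?thesis by (auto simp: tame_def)
qed

lemma homog_xy [simp]: "homog (Suc 0) (xg i)" "homog (Suc 0) (yg i)"
  by (simp_all add: xg_def yg_def)

lemma tame_xy [simp]: "tame (xg i)" "tame (yg i)"
  by (simp_all add: xg_def yg_def)

lemma xcode_ycode_simps [simp]:
  "xcode i \<noteq> ycode j" "ycode j \<noteq> xcode i" "xcode i = xcode j \<longleftrightarrow> i = j" "ycode i = ycode j \<longleftrightarrow> i = j"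
  unfolding xcode_def ycode_def by presburger+

section \<open>Derivatives and brackets of the V_n\<close>

lemma deriv_V_low: "c < 2 * n \<Longrightarrow> deriv_s c (V n) = 0"
  by (rule deriv_eq_zero) (use V_support_ge in \<open>force\<close>)

lemma deriv_V:
  "deriv_s c (V n) = deriv_s c (yg n)
    + (deriv_s c (xg n) \<star> (xg (n + 1) \<star> V (n + 3))
    + smul (-1) (xg n \<star> (deriv_s c (xg (n + 1)) \<star> V (n + 3))))
    + (xg n \<star> xg (n + 1)) \<star> deriv_s c (V (n + 3))"
  by (subst V_rec) (simp only: deriv_add mul_assoc deriv_mul[OF homog_xy(1)] mul_add_right
    mul_smul_right smul_add smul_smul, simp add: add.assoc)

lemma deriv_y_V_self: "deriv_s (ycode n) (V n) = one_s"
  by (subst deriv_V) (simp add: xg_def yg_def deriv_gen deriv_V_low ycode_def xcode_def)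

lemma deriv_y_V_rec:
  "j \<noteq> n \<Longrightarrow> deriv_s (ycode j) (V n) = (xg n \<star> xg (n + 1)) \<star> deriv_s (ycode j) (V (n + 3))"
  by (subst deriv_V) (simp add: xg_def yg_def deriv_gen)

lemma deriv_x_V_self: "deriv_s (xcode n) (V n) = xg (n + 1) \<star> V (n + 3)"
  by (subst deriv_V) (simp add: xg_def yg_def deriv_gen deriv_V_low mul_one_left xcode_def ycode_def)

lemma gen_square: "gen c \<star> gen c = 0"
proof (rule ccontr)
  assume "gen c \<star> gen c \<noteq> (0 :: 'a ser)"
  then obtain S where "(gen c \<star> gen c) S \<noteq> (0::'a)"
    by (auto simp: fun_eq_iff)
  then show False
    by (auto elim!: mul_supportE simp: gen_def split: if_splits)
qed

lemma x_square [simp]: "xg i \<star> xg i = 0"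
  by (simp add: xg_def gen_square)

lemma x_square_left [simp]: "xg i \<star> (xg i \<star> f) = 0"
  by (simp flip: mul_assoc)

lemma x_x_mid:
  "xg i \<star> (xg j \<star> (xg i \<star> f)) = 0"
proof -
  have "xg j \<star> xg i = smul (-1) (xg i \<star> xg j)"
    using mul_commute[OF homog_xy(1) homog_xy(1)] by simp
  then have "xg j \<star> (xg i \<star> f) = smul (-1) (xg i \<star> (xg j \<star> f))"
    by (metis mul_assoc mul_smul_left)
  then show ?thesis by (simp only: mul_smul_right) simp
qed

text \<open>Here V_n is y_n + x_n w with w even. Both summands are odd with square 0, and they
  anticommute.\<close>

lemma V_square: "V n \<star> V n = (0 :: 'a::field ser)"
proof -
  define w :: "'a ser" where "w = xg (n + 1) \<star> V (n + 3)"
  have w: "homog 2 w"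
    unfolding w_def using homog_mul[OF homog_xy(1) homog_V] by (simp add: numeral_2_eq_2)
  have V: "V n = yg n + xg n \<star> w"
    by (subst V_rec) (simp add: w_def mul_assoc)
  have z: "homog 3 (xg n \<star> w)"
    using homog_mul[OF homog_xy(1) w] by (simp add: numeral_3_eq_3)
  have "w \<star> xg n = xg n \<star> w"
    using mul_commute[OF w homog_xy(1)] by simp
  then have 1: "(xg n \<star> w) \<star> (xg n \<star> w) = 0"
    by (metis mul_assoc mul_zero(1) x_square)
  have "yg n \<star> (xg n \<star> w) = smul (-1) ((xg n \<star> w) \<star> yg n)"
    using mul_commute[OF homog_xy(2) z] by simp
  then have 2: "yg n \<star> (xg n \<star> w) + (xg n \<star> w) \<star> yg n = 0"
    by simp
  have "V n \<star> V n = yg n \<star> yg n + (yg n \<star> (xg n \<star> w) + (xg n \<star> w) \<star> yg n) + (xg n \<star> w) \<star> (xg n \<star> w)"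
    unfolding V by (simp only: mul_add_left mul_add_right ac_simps)
  then show ?thesis
    unfolding 1 2 by (simp add: yg_def gen_square)
qed

lemma br_odd_commute:
  assumes "homog (Suc 0) f" "homog (Suc 0) g" "tame f" "tame g"
  shows "br g f = br f g"
  using br_commute[OF assms] by simp

lemma br_V_x: "br (V n) (xg j) = deriv_s (ycode j) (V n)"
  using br_odd_commute[of "xg j" "V n"] by (simp add: br_gen)

lemma br_V_V_commute: "br (V m) (V n) = br (V n) (V m)"
  by (rule br_odd_commute) auto

text \<open>Expands the first argument by \<open>V_rec\<close> and applies the Leibniz rule. The
  brackets needed later arise from this formula once most of its terms vanish.\<close>

lemma br_V_V:
  "br (V n) (V m) = deriv_s (xcode n) (V m) + ((xg n \<star> xg (n + 1)) \<star> br (V (n + 3)) (V m)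
    + (smul (-1) (xg n \<star> (deriv_s (ycode (n + 1)) (V m) \<star> V (n + 3)))
    + deriv_s (ycode n) (V m) \<star> (xg (n + 1) \<star> V (n + 3))))"
proof -
  have xx: "homog (Suc 0 + Suc 0) (xg n \<star> xg (n + 1))"
    by (intro homog_mul homog_xy)
  have "br (V n) (V m) = br (yg n) (V m) + br ((xg n \<star> xg (n + 1)) \<star> V (n + 3)) (V m)"
    by (subst V_rec) (simp add: br_add_left)
  also have "br (yg n) (V m) = deriv_s (xcode n) (V m)"
    by (simp add: br_gen)
  also have "br ((xg n \<star> xg (n + 1)) \<star> V (n + 3)) (V m) = (xg n \<star> xg (n + 1)) \<star> br (V (n + 3)) (V m)
      + smul (-1) (br (xg n \<star> xg (n + 1)) (V m) \<star> V (n + 3))"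
    by (subst br_mul_left[OF xx homog_V homog_V]) auto
  also have "br (xg n \<star> xg (n + 1)) (V m) = xg n \<star> deriv_s (ycode (n + 1)) (V m)
      + smul (-1) (deriv_s (ycode n) (V m) \<star> xg (n + 1))"
    by (subst br_mul_left[OF homog_xy(1) homog_xy(1) homog_V]) (auto simp: br_gen)
  finally show ?thesis
    by (simp only: mul_add_left mul_smul_left mul_assoc smul_add smul_smul) (simp add: fun_eq_iff)
qed

text \<open>None of x_n, y_n, y_(n+1) occurs in V_m, so only the recursive term survives.\<close>

lemma br_V_V_far:
  "n + 2 \<le> m \<Longrightarrow> br (V n) (V m) = (xg n \<star> xg (n + 1)) \<star> br (V (n + 3)) (V m)"
  by (subst br_V_V) (simp add: deriv_V_low xcode_def ycode_def)

lemma br_V_V_self: "br (V n) (V n) = (smul 2 (xg (n + 1) \<star> V (n + 3)) :: 'a::field ser)"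
proof -
  \<comment> \<open>The recursive term dies because this bracket already carries the factor x_n.
    What is left is the same element twice, once from the derivative by x_n and once from that by
    y_n.\<close>
  have "br (V (n + 3)) (V n) = ((xg n \<star> xg (n + 1)) \<star> br (V (n + 3)) (V (n + 3)) :: 'a ser)"
    unfolding br_V_V_commute[of "n + 3" n] by (rule br_V_V_far) simp
  then have 1: "(xg n \<star> xg (n + 1)) \<star> br (V (n + 3)) (V n) = (0 :: 'a ser)"
    by (simp add: mul_assoc x_x_mid)
  have 2: "deriv_s (ycode (n + 1)) (V n) = xg n \<star> (xg (n + 1) \<star> 0)"
    by (subst deriv_y_V_rec) (auto simp: deriv_V_low ycode_def)
  show ?thesis
    by (subst br_V_V, subst 1, subst 2)
      (simp add: deriv_y_V_self deriv_x_V_self mul_one_left, simp add: fun_eq_iff smul_def)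
qed

lemma br_V_V_Suc: "br (V n) (V (n + 1)) = (smul (-1) (xg n \<star> V (n + 3)) :: 'a::field ser)"
proof -
  \<comment> \<open>This bracket starts with x_(n+1), which the prefix of the recursive term
    annihilates; only the derivative of V_(n+1) by its own y remains.\<close>
  have "br (V (n + 3)) (V (n + 1)) = ((xg (n + 1) \<star> xg (n + 2)) \<star> br (V (n + 4)) (V (n + 3)) :: 'a ser)"
    unfolding br_V_V_commute[of "n + 3" "n + 1"]
    using br_V_V_far[of "n + 1" "n + 3"] by (simp add: add.commute)
  then have 1: "(xg n \<star> xg (n + 1)) \<star> br (V (n + 3)) (V (n + 1)) = (0 :: 'a ser)"
    by (simp add: mul_assoc)
  have 2: "deriv_s (xcode n) (V (n + 1)) = 0" "deriv_s (ycode n) (V (n + 1)) = 0"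
    by (simp_all add: deriv_V_low xcode_def ycode_def)
  show ?thesis
    by (subst br_V_V, subst 1, subst 2, subst 2)
      (simp add: deriv_y_V_self mul_one_left tame_fin_supp)
qed

lemma br_V_V_Suc2:
  "br (V n) (V (n + 2)) = (smul (-1) (xg n \<star> (xg (n + 1) \<star> (xg (n + 2) \<star> V (n + 5)))) :: 'a::field ser)"
proof -
  have "br (V (n + 3)) (V (n + 2)) = (smul (-1) (xg (n + 2) \<star> V (n + 5)) :: 'a ser)"
    unfolding br_V_V_commute[of "n + 3" "n + 2"]
    using br_V_V_Suc[of "n + 2"] by (simp add: eval_nat_numeral)
  then show ?thesis
    by (subst br_V_V_far) (simp_all only: mul_smul_right mul_assoc)
qed

section \<open>Words in the letters x_i and V_n\<close>

datatype letter = LX nat | LV nat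

primrec val :: "letter \<Rightarrow> 'k::field ser" where
  "val (LX i) = xg i"
| "val (LV n) = V n"

text \<open>Words are kept apart from their values because weights are attached to words, while
  \<open>ev\<close> is not injective.\<close>

primrec ev :: "letter list \<Rightarrow> 'k::field ser" where
  "ev [] = one_s"
| "ev (a # w) = val a \<star> ev w"

lemma homog_val [simp]: "homog (Suc 0) (val a)"
  by (cases a) auto

lemma tame_val [simp]: "tame (val a)"
  by (cases a) auto

lemma val_square: "val a \<star> val a = 0"
  by (cases a) (auto simp: V_square)

lemma tame_ev [simp]: "tame (ev w)"
  by (induction w) auto

lemma homog_ev: "homog (length w) (ev w)"
proof (induction w)
  case (Cons a w)
  then show ?case using homog_mul[OF homog_val Cons.IH, of a] by simp
qed simp

lemma ev_append: "ev (u @ v) = ev u \<star> ev v"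
  by (induction u) (auto simp: mul_one_left tame_fin_supp mul_assoc)

lemma ev_val_commute: "ev w \<star> val a = smul ((-1) ^ length w) (val a \<star> ev w)"
  using mul_commute[OF homog_ev homog_val] by simp

text \<open>The letters anticommute with each other up to sign, so two equal ones can be made
  adjacent, and every letter has square 0.\<close>

lemma ev_not_distinct:
  assumes "\<not> distinct w"
  shows "ev w = (0 :: 'a::field ser)"
proof -
  obtain xs ys zs a where w: "w = xs @ [a] @ ys @ [a] @ zs"
    using assms not_distinct_decomp by blast
  have "ev w = (ev xs \<star> (val a \<star> (ev ys \<star> val a) \<star> ev zs) :: 'a ser)"
    by (simp add: w ev_append mul_assoc)
  also have "val a \<star> (ev ys \<star> val a) = (smul ((-1) ^ length ys) ((val a \<star> val a) \<star> ev ys) :: 'a ser)"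
    by (simp add: ev_val_commute mul_smul_right mul_assoc)
  finally show ?thesis
    by (simp only: val_square mul_zero smul_zero)
qed

section \<open>Weights and brackets of words\<close>

text \<open>Series often get eta-expanded by unification; the pointwise rules would then rewrite the series
  \<open>0\<close>, \<open>f + g\<close>, \<open>- f\<close> to abstractions on which the algebraic rules no longer fire.\<close>

declare zero_fun_apply [simp del] plus_fun_apply [simp del]
  uminus_apply [simp del] minus_apply [simp del]

text \<open>Linearity is asked for only on the span of \<open>B\<close>, because the bracket is
  shown to be linear only on tame series.\<close>

lemma span_image:
  fixes T :: "'k::field ser \<Rightarrow> 'k ser"
  assumes f: "f \<in> ser.span B"
    and B: "\<And>b. b \<in> B \<Longrightarrow> T b \<in> ser.span C"
    and add: "\<And>f g. f \<in> ser.span B \<Longrightarrow> g \<in> ser.span B \<Longrightarrow> T (f + g) = T f + T g"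
    and scale: "\<And>c f. f \<in> ser.span B \<Longrightarrow> T (smul c f) = smul c (T f)"
  shows "T f \<in> ser.span C"
proof -
  have T0: "T 0 = 0"
    using scale[OF ser.span_zero, of 0] by simp
  have "f \<in> ser.span B \<and> T f \<in> ser.span C"
    using f
  proof (induction rule: ser.span_induct_alt)
    case base
    then show ?case by (simp add: T0 ser.span_zero)
  next
    case (step c x y)
    then have x: "x \<in> ser.span B"
      by (simp add: ser.span_base)
    then show ?case
      using step B[of x] add[of "smul c x" y] scale[of x c]
      by (simp add: ser.span_add ser.span_scale)
  qed
  then show ?thesis ..
qed

locale growth_rate =
  fixes lam :: real
  assumes root: "lam ^ 3 - lam - 2 = 0"
begin

lemma lam_gt: "3 / 2 < lam"
proof (rule ccontr)
  assume "\<not> ?thesis"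
  \<comment> \<open>The polynomial takes the value -1/8 at 3/2. Its quotient by
    \<open>lam - 3 / 2\<close>, with the square completed, is positive, so there is no root up to
    3/2.\<close>
  then have "(lam - 3 / 2) * ((lam + 3 / 4) ^ 2 + 11 / 16) \<le> 0"
    by (intro mult_nonpos_nonneg add_nonneg_nonneg) auto
  moreover have "lam ^ 3 - lam - 2 = (lam - 3 / 2) * ((lam + 3 / 4) ^ 2 + 11 / 16) - 1 / 8"
    by (simp add: power2_eq_square power3_eq_cube field_simps)
  ultimately have "\<exists>z\<le>0. lam ^ 3 - lam - 2 = z - 1 / 8"
    by blast
  then show False
    using root by auto
qed

lemma lam_power_pos [simp]: "0 < lam ^ n"
  using lam_gt by simp

lemma lam_rec: "lam ^ (n + 3) = lam ^ (n + 1) + 2 * lam ^ n"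
proof -
  have "lam ^ (n + 3) = lam ^ n * (lam + 2)"
    using root by (simp add: power_add)
  then show ?thesis by (simp add: algebra_simps)
qed

primrec lwt :: "letter \<Rightarrow> real" where
  "lwt (LX i) = - (lam ^ i)"
| "lwt (LV n) = lam ^ n"

definition wt :: "letter list \<Rightarrow> real" where
  "wt w = sum_list (map lwt w)"

lemma wt_simps [simp]:
  "wt [] = 0" "wt (a # w) = lwt a + wt w" "wt (u @ w) = wt u + wt w"
  by (simp_all add: wt_def)

end

definition xV :: "nat list \<Rightarrow> nat \<Rightarrow> letter list" where
  "xV xs n = map LX xs @ [LV n]"

text \<open>The product \<open>x\<^sub>n\<^sub>-\<^sub>3 x\<^sub>n\<^sub>-\<^sub>2 V\<^sub>n\<close> is excluded: it only occurs as part of \<open>V\<^sub>n\<^sub>-\<^sub>3\<close>, and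
  allowing it would destroy the positivity of the weights.\<close>

definition small :: "nat list \<Rightarrow> nat \<Rightarrow> bool" where
  "small xs n \<longleftrightarrow> (\<forall>i\<in>set xs. i + 2 \<le> n) \<and> (\<forall>i. i + 3 = n \<longrightarrow> \<not> (i \<in> set xs \<and> i + 1 \<in> set xs))"

text \<open>New indices of at most \<open>n - 4\<close> respect the bound \<open>n - 2\<close> and
  cannot complete the forbidden pair.\<close>

lemma small_extend:
  assumes "small p n" "\<forall>i\<in>A. i + 4 \<le> n" "set q \<subseteq> set p \<union> A"
  shows "small q n"
  unfolding small_def
proof (intro conjI ballI allI impI notI)
  fix i assume "i \<in> set q"
  then show "i + 2 \<le> n"
    using assms unfolding small_def by fastforce
next
  fix i assume i: "i + 3 = n" "i \<in> set q \<and> i + 1 \<in> set q"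
  then have "i \<notin> A" "i + 1 \<notin> A"
    using assms(2) by force+
  then show False
    using assms i unfolding small_def by blast
qed

context growth_rate
begin

text \<open>Each step of the recursion from V_n to V_(n+3) contributes x_n x_(n+1), of weight
  \<open>lam ^ n - lam ^ (n + 3)\<close>, so the weights telescope. The value \<open>c = 0\<close>
  covers the y_j that do not occur in V_n.\<close>

lemma deriv_y_V_word:
  obtains c p where "deriv_s (ycode j) (V n) = smul c (ev (map LX p) :: 'k::field ser)"
    "c \<noteq> 0 \<Longrightarrow> n \<le> j \<and> (\<forall>i\<in>set p. i + 2 \<le> j) \<and> wt (map LX p) = lam ^ n - lam ^ j"
proof -
  have "\<exists>c p. deriv_s (ycode j) (V n) = smul c (ev (map LX p) :: 'k ser) \<and>
    (c \<noteq> 0 \<longrightarrow> n \<le> j \<and> (\<forall>i\<in>set p. i + 2 \<le> j) \<and> wt (map LX p) = lam ^ n - lam ^ j)"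
  proof (induction "j - n" arbitrary: n rule: less_induct)
    case less
    consider "j < n" | "j = n" | "n < j" by linarith
    then show ?case
    proof cases
      case 1
      then have "deriv_s (ycode j) (V n) = smul 0 (ev (map LX []) :: 'k ser)"
        by (simp add: deriv_V_low ycode_def)
      then show ?thesis by blast
    next
      case 2
      then have "deriv_s (ycode j) (V n) = smul 1 (ev (map LX []) :: 'k ser)"
        by (simp add: deriv_y_V_self)
      then show ?thesis using 2 by (intro exI[of _ 1] exI[of _ "[]"]) auto
    next
      case 3
      then obtain c p where IH: "deriv_s (ycode j) (V (n + 3)) = smul c (ev (map LX p) :: 'k ser)"
        "c \<noteq> 0 \<longrightarrow> n + 3 \<le> j \<and> (\<forall>i\<in>set p. i + 2 \<le> j) \<and> wt (map LX p) = lam ^ (n + 3) - lam ^ j"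
        using less[of "n + 3"] diff_less_mono2[of n "n + 3" j] by auto
      have "deriv_s (ycode j) (V n) = smul c (ev (map LX (n # (n + 1) # p)) :: 'k ser)"
        using 3 by (subst deriv_y_V_rec) (simp_all add: IH(1) mul_smul_right mul_assoc)
      moreover have "c \<noteq> 0 \<longrightarrow> n \<le> j \<and> (\<forall>i\<in>set (n # (n + 1) # p). i + 2 \<le> j) \<and>
          wt (map LX (n # (n + 1) # p)) = lam ^ n - lam ^ j"
        using IH(2) lam_rec[of n] by auto
      ultimately show ?thesis by blast
    qed
  qed
  then show thesis using that by blast
qed

text \<open>Stripping x_n x_(n+1) raises the smaller index by 3 until the indices differ by at most
  2, where the bracket is known. The bound \<open>m + 2 \<le> N\<close> keeps the word small when
  factors are put in front.\<close>

lemma br_V_V_word: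
  assumes "n \<le> m"
  obtains c p N where "br (V n) (V m) = smul c (ev (xV p N) :: 'k::field ser)"
    "small p N" "m + 2 \<le> N" "wt (xV p N) = lam ^ n + lam ^ m"
proof -
  have "\<exists>c p N. br (V n) (V m) = smul c (ev (xV p N) :: 'k ser) \<and>
    small p N \<and> m + 2 \<le> N \<and> wt (xV p N) = lam ^ n + lam ^ m"
    using assms
  proof (induction "m - n" arbitrary: n rule: less_induct)
    case less
    from \<open>n \<le> m\<close> consider "m = n" | "m = n + 1" | "m = n + 2" | "n + 3 \<le> m" by linarith
    then show ?case
    proof cases
      case 1
      have "br (V n) (V m) = smul 2 (ev (xV [n + 1] (n + 3)) :: 'k ser)"
        using br_V_V_self[of n] by (simp add: xV_def 1 mul_one_right tame_fin_supp)
      then show ?thesis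
        using lam_rec[of n]
        by (intro exI[of _ 2] exI[of _ "[n + 1]"] exI[of _ "n + 3"]) (auto simp: small_def xV_def 1)
    next
      case 2
      have "br (V n) (V m) = smul (-1) (ev (xV [n] (n + 3)) :: 'k ser)"
        using br_V_V_Suc[of n] by (simp add: xV_def 2 mul_one_right tame_fin_supp)
      then show ?thesis
        using lam_rec[of n]
        by (intro exI[of _ "-1"] exI[of _ "[n]"] exI[of _ "n + 3"]) (auto simp: small_def xV_def 2)
    next
      case 3
      have "br (V n) (V m) = smul (-1) (ev (xV [n, n + 1, n + 2] (n + 5)) :: 'k ser)"
        using br_V_V_Suc2[of n] by (simp add: xV_def 3 mul_one_right tame_fin_supp)
      then show ?thesis
        using lam_rec[of n] lam_rec[of "n + 2"]
        by (intro exI[of _ "-1"] exI[of _ "[n, n + 1, n + 2]"] exI[of _ "n + 5"])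
          (auto simp: small_def xV_def 3 eval_nat_numeral)
    next
      case 4
      then obtain c p N where IH: "br (V (n + 3)) (V m) = smul c (ev (xV p N) :: 'k ser)"
        "small p N" "m + 2 \<le> N" "wt (xV p N) = lam ^ (n + 3) + lam ^ m"
        using less.hyps[of "n + 3"] diff_less_mono2[of n "n + 3" m] by auto
      have "br (V n) (V m) = smul c (ev (xV (n # (n + 1) # p) N) :: 'k ser)"
        using 4 by (subst br_V_V_far) (simp_all add: IH(1) mul_smul_right mul_assoc xV_def)
      moreover have "small (n # (n + 1) # p) N"
        using IH(2,3) 4 by (auto simp: small_def)
      moreover have "wt (xV (n # (n + 1) # p) N) = lam ^ n + lam ^ m"
        using IH(4) lam_rec[of n] by (simp add: xV_def)
      ultimately show ?thesis using IH(3) by blast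
    qed
  qed
  then show thesis using that by blast
qed

section \<open>Closure of the small words under the bracket\<close>

definition lspan :: "real \<Rightarrow> 'k::field ser set" where
  "lspan w = ser.span {ev (xV xs n) | xs n. distinct xs \<and> small xs n \<and> wt (xV xs n) = w}"

lemma lspan_scale: "f \<in> lspan w \<Longrightarrow> smul c f \<in> lspan w"
  unfolding lspan_def by (rule ser.span_scale)

lemma ev_in_lspan:
  assumes "small xs n" "wt (xV xs n) = w"
  shows "(ev (xV xs n) :: 'k::field ser) \<in> lspan w"
proof (cases "distinct xs")
  case True
  then show ?thesis
    unfolding lspan_def using assms by (intro ser.span_base) auto
next
  case False
  then have "\<not> distinct (xV xs n)"
    by (auto simp: xV_def distinct_map inj_on_def)
  then show ?thesis
    by (simp add: ev_not_distinct lspan_def ser.span_zero)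
qed

lemma deriv_y_xword: "deriv_s (ycode i) (ev (map LX ys)) = (0 :: 'k::field ser)"
proof (induction ys)
  case (Cons j ys)
  have "deriv_s (ycode i) (xg j) = (0 :: 'k ser)"
    by (simp add: xg_def deriv_gen)
  then show ?case
    using Cons by (simp add: deriv_mul[OF homog_xy(1)])
qed simp

text \<open>Bracketing with x_i is the derivative by y_i, and y_i occurs neither in an x-word nor in
  V_m for \<open>i < m\<close>.\<close>

lemma br_xword_low:
  assumes "\<forall>i\<in>set xs. i < m"
  shows "br (ev (map LX xs)) (ev (xV ys m)) = (0 :: 'k::field ser)"
  using assms
proof (induction xs)
  case (Cons i xs)
  have "deriv_s (ycode i) (ev (xV ys m)) = (0 :: 'k ser)"
    using Cons.prems deriv_V_low[of "ycode i" m, where 'a='k]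
    by (simp add: xV_def ev_append deriv_mul[OF homog_ev] deriv_y_xword ycode_def[of i, symmetric]
      mul_one_right tame_fin_supp) (simp add: ycode_def)
  then show ?case
    using Cons br_mul_left[OF homog_xy(1) homog_ev homog_ev, of i "map LX xs" "xV ys m", where 'a='k]
    by (simp add: br_gen)
qed simp

text \<open>V_n acts as a derivation that replaces one letter x_j by the x-word of the derivative of
  V_n by y_j.\<close>

lemma br_V_xword:
  "br (V n) (ev (map LX ys) :: 'k::field ser) \<in> ser.span {ev (map LX (as @ p @ bs)) | as p bs j.
    ys = as @ j # bs \<and> n \<le> j \<and> (\<forall>i\<in>set p. i + 2 \<le> j) \<and> wt (map LX p) = lam ^ n - lam ^ j}"
  (is "_ \<in> ser.span (?B ys)")
proof (induction ys)
  case Nil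
  then show ?case by (simp add: ser.span_zero)
next
  case (Cons j ys)
  obtain c p where dV: "deriv_s (ycode j) (V n) = smul c (ev (map LX p) :: 'k::field ser)"
    "c \<noteq> 0 \<Longrightarrow> n \<le> j \<and> (\<forall>i\<in>set p. i + 2 \<le> j) \<and> wt (map LX p) = lam ^ n - lam ^ j"
    by (rule deriv_y_V_word) blast
  have 1: "smul c (ev (map LX ([] @ p @ ys))) \<in> ser.span (?B (j # ys))"
  proof (cases "c = 0")
    case True
    then show ?thesis by (simp only: smul_0_left ser.span_zero)
  next
    case False
    show ?thesis
      by (intro ser.span_scale ser.span_base CollectI exI[of _ "[]"] exI[of _ p] exI[of _ ys] exI[of _ j])
        (use dV(2)[OF False] in auto)
  qed
  have 2: "xg j \<star> br (V n) (ev (map LX ys)) \<in> ser.span (?B (j # ys))"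
    using Cons.IH
  proof (rule span_image[where T = "\<lambda>f. xg j \<star> f"])
    fix b assume "b \<in> ?B ys"
    then obtain as p bs k where b: "b = ev (map LX (as @ p @ bs))" "ys = as @ k # bs"
      "n \<le> k \<and> (\<forall>i\<in>set p. i + 2 \<le> k) \<and> wt (map LX p) = lam ^ n - lam ^ k"
      by blast
    have "xg j \<star> b = ev (map LX ((j # as) @ p @ bs))"
      by (simp add: b)
    then show "xg j \<star> b \<in> ser.span (?B (j # ys))"
      using b(2,3) by (intro ser.span_base CollectI exI[of _ "j # as"] exI[of _ p] exI[of _ bs] exI[of _ k]) auto
  qed (simp_all add: mul_add_right mul_smul_right)
  have "br (V n) (ev (map LX (j # ys))) = (br (V n) (xg j) \<star> ev (map LX ys)
      + smul (-1) (xg j \<star> br (V n) (ev (map LX ys))) :: 'k ser)"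
    using br_mul_right[OF homog_V homog_xy(1), of n j "ev (map LX ys) :: 'k ser"] by simp
  also have "br (V n) (xg j) \<star> ev (map LX ys) = (smul c (ev (map LX ([] @ p @ ys))) :: 'k ser)"
    by (simp only: br_V_x dV(1) mul_smul_left ev_append map_append append_Nil)
  finally show ?case
    using 1 2 by (simp only: ser.span_add ser.span_scale)
qed

text \<open>With \<open>n \<le> m\<close> the x-prefix of the first word has bracket 0 with the
  second word. So only V_n acts, either on V_m or on a letter x_j of \<open>ys\<close> with
  \<open>n \<le> j\<close>; both results are small and have the right weight.\<close>

lemma br_lword_le:
  assumes xs: "small xs n" and ys: "small ys m" and "n \<le> m"
  shows "br (ev (xV xs n)) (ev (xV ys m) :: 'k::field ser) \<in> lspan (wt (xV xs n) + wt (xV ys m))"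
proof -
  let ?r = "ev (map LX xs) :: 'k ser" and ?s = "ev (map LX ys) :: 'k ser"
  let ?G = "ev (xV ys m) :: 'k ser" and ?w = "wt (xV xs n) + wt (xV ys m)"
  have ev: "ev (xV zs k) = (ev (map LX zs) \<star> V k :: 'k ser)" for zs k
    by (simp add: xV_def ev_append mul_one_right tame_fin_supp)
  have "br ?r ?G = 0"
    using xs \<open>n \<le> m\<close> by (intro br_xword_low) (force simp: small_def)
  then have "br (ev (xV xs n)) ?G = ?r \<star> br (V n) ?G"
    unfolding ev[of xs] using br_mul_left[of "length (map LX xs)" ?r "Suc 0" "V n" "length (xV ys m)" ?G]
    by (simp add: homog_ev del: length_map)
  also have "br (V n) ?G = br (V n) ?s \<star> V m + smul ((-1) ^ (1 * length (map LX ys))) (?s \<star> br (V n) (V m))"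
    unfolding ev[of ys] using br_mul_right[OF homog_V homog_ev, of n "map LX ys" "V m :: 'k ser"] by simp
  finally have eq: "br (ev (xV xs n)) ?G = ?r \<star> (br (V n) ?s \<star> V m)
      + smul ((-1) ^ (1 * length (map LX ys))) (?r \<star> (?s \<star> br (V n) (V m)))"
    by (simp only: mul_add_right mul_smul_right)
  obtain c p N where pN: "br (V n) (V m) = smul c (ev (xV p N) :: 'k::field ser)"
    "small p N" "m + 2 \<le> N" "wt (xV p N) = lam ^ n + lam ^ m"
    using \<open>n \<le> m\<close> by (rule br_V_V_word)
  have "?r \<star> (?s \<star> br (V n) (V m)) = smul c (ev (xV (xs @ ys @ p) N))"
    by (simp only: pN(1) mul_smul_right) (simp add: xV_def ev_append mul_assoc)
  moreover have "small (xs @ ys @ p) N"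
  proof (rule small_extend[OF pN(2)])
    show "\<forall>i\<in>set xs \<union> set ys. i + 4 \<le> N"
      using xs ys pN(3) \<open>n \<le> m\<close> unfolding small_def by fastforce
  qed auto
  moreover have "wt (xV (xs @ ys @ p) N) = ?w"
    using pN(4) by (simp add: xV_def)
  ultimately have 1: "?r \<star> (?s \<star> br (V n) (V m)) \<in> lspan ?w"
    by (simp only: lspan_scale ev_in_lspan)
  have 2: "?r \<star> (br (V n) ?s \<star> V m) \<in> lspan ?w"
    unfolding lspan_def using br_V_xword[of n ys]
  proof (rule span_image[where T = "\<lambda>f. ?r \<star> (f \<star> V m)"])
    fix b :: "'k ser"
    assume "b \<in> {ev (map LX (as @ p @ bs)) | as p bs j.
      ys = as @ j # bs \<and> n \<le> j \<and> (\<forall>i\<in>set p. i + 2 \<le> j) \<and> wt (map LX p) = lam ^ n - lam ^ j}"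
    then obtain as p bs j where b: "b = ev (map LX (as @ p @ bs))" "ys = as @ j # bs" "n \<le> j"
      "\<forall>i\<in>set p. i + 2 \<le> j" "wt (map LX p) = lam ^ n - lam ^ j"
      by blast
    have "?r \<star> (b \<star> V m) = ev (xV (xs @ as @ p @ bs) m)"
      by (simp add: b(1) ev ev_append mul_assoc)
    moreover have "small (xs @ as @ p @ bs) m"
    proof -
      have j: "j + 2 \<le> m"
        using ys b(2) by (auto simp: small_def)
      \<comment> \<open>The indices in \<open>xs\<close> are at most \<open>n - 2\<close> and those
        in \<open>p\<close> at most \<open>j - 2\<close>, while
        \<open>n \<le> j \<le> m - 2\<close>.\<close>
      then have "\<forall>i\<in>set xs \<union> set p. i + 4 \<le> m"
        using xs b(3,4) unfolding small_def by fastforce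
      then show ?thesis
        by (rule small_extend[OF ys]) (auto simp: b(2))
    qed
    moreover have "wt (xV (xs @ as @ p @ bs) m) = ?w"
      using b(2,5) by (simp add: xV_def)
    ultimately have "?r \<star> (b \<star> V m) \<in> lspan ?w"
      by (simp only: ev_in_lspan)
    then show "?r \<star> (b \<star> V m) \<in> ser.span {ev (xV xs' n') | xs' n'. distinct xs' \<and> small xs' n' \<and> wt (xV xs' n') = ?w}"
      unfolding lspan_def .
  qed (simp_all add: mul_add_right mul_smul_right mul_add_left mul_smul_left)
  show ?thesis
    unfolding eq using 1 2 unfolding lspan_def by (intro ser.span_add ser.span_scale)
qed

lemma br_lword:
  assumes "small xs n" "small ys m"
  shows "br (ev (xV xs n)) (ev (xV ys m) :: 'k::field ser) \<in> lspan (wt (xV xs n) + wt (xV ys m))"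
proof (cases "n \<le> m")
  case True
  then show ?thesis using assms by (intro br_lword_le)
next
  case False
  then have "br (ev (xV ys m)) (ev (xV xs n) :: 'k ser) \<in> lspan (wt (xV ys m) + wt (xV xs n))"
    using assms by (intro br_lword_le) auto
  moreover have "br (ev (xV xs n)) (ev (xV ys m) :: 'k ser) =
      smul (- ((-1) ^ (length (xV ys m) * length (xV xs n)))) (br (ev (xV ys m)) (ev (xV xs n)))"
    by (intro br_commute homog_ev tame_ev)
  ultimately show ?thesis
    unfolding lspan_def by (simp only: add.commute ser.span_scale)
qed

end

section \<open>The upper bound\<close>

lemma jprod_comps:
  "kfst (jprod u v) = kfst u \<star> kfst v + br (ksnd u) (par_sign (ksnd v))"
  "ksnd (jprod u v) = ksnd u \<star> par_sign (kfst v) + kfst u \<star> ksnd v"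
  by (simp_all add: jprod_def kpair_def kfst_def[of "case_prod _"] ksnd_def[of "case_prod _"] fun_eq_iff plus_fun_apply)

lemma kpair_comps [simp]: "kfst (kpair a b) = a" "ksnd (kpair a b) = b"
  by (simp_all add: kpair_def kfst_def ksnd_def)

lemma kpair_eta: "kpair (kfst u) (ksnd u) = u"
  by (auto simp: kpair_def kfst_def ksnd_def fun_eq_iff)

context growth_rate
begin

section \<open>Weight filtration by products of small words\<close>

definition lwords :: "letter list list \<Rightarrow> bool" where
  "lwords us \<longleftrightarrow> (\<forall>u\<in>set us. \<exists>xs n. u = xV xs n \<and> distinct xs \<and> small xs n)"

definition pspan :: "real \<Rightarrow> 'k::field ser set" where
  "pspan w = ser.span {ev (concat us) | us. lwords us \<and> wt (concat us) \<le> w}"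

lemma pspan_add: "f \<in> pspan w \<Longrightarrow> g \<in> pspan w \<Longrightarrow> f + g \<in> pspan w"
  unfolding pspan_def by (rule ser.span_add)

lemma pspan_scale: "f \<in> pspan w \<Longrightarrow> smul c f \<in> pspan w"
  unfolding pspan_def by (rule ser.span_scale)

lemma pspan_zero: "0 \<in> pspan w"
  unfolding pspan_def by (rule ser.span_zero)

lemma ev_in_pspan: "lwords us \<Longrightarrow> wt (concat us) \<le> w \<Longrightarrow> ev (concat us) \<in> pspan w"
  unfolding pspan_def by (intro ser.span_base) auto

lemma pspan_mono: "v \<le> w \<Longrightarrow> pspan v \<subseteq> pspan w"
  unfolding pspan_def by (intro ser.span_mono) auto

lemma pspan_image:
  fixes T :: "'k::field ser \<Rightarrow> 'k ser"
  assumes "f \<in> pspan w"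
    and "\<And>us. lwords us \<Longrightarrow> wt (concat us) \<le> w \<Longrightarrow> T (ev (concat us)) \<in> pspan v"
    and "\<And>f g. f \<in> pspan w \<Longrightarrow> g \<in> pspan w \<Longrightarrow> T (f + g) = T f + T g"
    and "\<And>c f. f \<in> pspan w \<Longrightarrow> T (smul c f) = smul c (T f)"
  shows "T f \<in> pspan v"
  unfolding pspan_def[of v]
  by (rule span_image[OF assms(1)[unfolded pspan_def]])
    (use assms(2-4) in \<open>auto simp: pspan_def\<close>)

lemma tame_pspan: "f \<in> pspan w \<Longrightarrow> tame f"
  unfolding pspan_def by (induction rule: ser.span_induct_alt) auto

lemma lspan_pspan: "lspan w \<subseteq> pspan w"
  unfolding lspan_def pspan_def
proof (rule ser.span_mono, rule subsetI)
  fix f :: "'a ser"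
  assume "f \<in> {ev (xV xs n) | xs n. distinct xs \<and> small xs n \<and> wt (xV xs n) = w}"
  then obtain xs n where "f = ev (concat [xV xs n])" "lwords [xV xs n]" "wt (concat [xV xs n]) \<le> w"
    by (auto simp: lwords_def)
  then show "f \<in> {ev (concat us) | us. lwords us \<and> wt (concat us) \<le> w}"
    by blast
qed

lemma mul_pspan:
  fixes f :: "'k::field ser"
  assumes "f \<in> pspan v" "g \<in> pspan w"
  shows "f \<star> g \<in> pspan (v + w)"
proof (rule pspan_image[OF assms(1), where T = "\<lambda>f. f \<star> g"])
  fix us assume us: "lwords us" "wt (concat us) \<le> v"
  show "ev (concat us) \<star> g \<in> pspan (v + w)"
  proof (rule pspan_image[OF assms(2), where T = "\<lambda>g. ev (concat us) \<star> g"])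
    fix vs assume vs: "lwords vs" "wt (concat vs) \<le> w"
    have "ev (concat us) \<star> ev (concat vs) = (ev (concat (us @ vs)) :: 'k ser)"
      by (simp add: ev_append)
    then show "ev (concat us) \<star> ev (concat vs) \<in> (pspan (v + w) :: 'k ser set)"
      using us vs ev_in_pspan[of "us @ vs" "v + w"] by (simp add: lwords_def Ball_def)
  qed (simp_all add: mul_add_right mul_smul_right)
qed (simp_all add: mul_add_left mul_smul_left)

text \<open>The Leibniz rule distributes the bracket over the factors; each single bracket of small
  words adds weights, and so does each product.\<close>

lemma br_lword_pspan:
  assumes "small xs n" "lwords vs"
  shows "br (ev (xV xs n)) (ev (concat vs) :: 'k::field ser) \<in> pspan (wt (xV xs n) + wt (concat vs))"
  using assms(2)
proof (induction vs)
  case Nil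
  then show ?case by (simp add: pspan_zero)
next
  case (Cons v vs)
  let ?u = "xV xs n"
  from Cons.prems obtain ys m where v: "v = xV ys m" "distinct ys" "small ys m"
    by (auto simp: lwords_def)
  have vs: "lwords vs" and lv: "lwords [v]"
    using Cons.prems by (auto simp: lwords_def)
  have "br (ev ?u) (ev v) \<in> (pspan (wt ?u + wt v) :: 'k ser set)"
    using br_lword[OF assms(1) v(3)] lspan_pspan v(1) by blast
  then have "br (ev ?u) (ev v) \<star> ev (concat vs) \<in> (pspan (wt ?u + wt v + wt (concat vs)) :: 'k ser set)"
    using vs by (intro mul_pspan ev_in_pspan) auto
  moreover have "ev (concat [v]) \<star> br (ev ?u) (ev (concat vs))
      \<in> (pspan (wt (concat [v]) + (wt ?u + wt (concat vs))) :: 'k ser set)"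
    using vs lv Cons.IH by (intro mul_pspan ev_in_pspan) auto
  moreover have "br (ev ?u) (ev v \<star> ev (concat vs)) = (br (ev ?u) (ev v) \<star> ev (concat vs)
      + smul ((-1) ^ (length ?u * length v)) (ev v \<star> br (ev ?u) (ev (concat vs))) :: 'k ser)"
    by (intro br_mul_right homog_ev tame_ev)
  ultimately show ?case
    by (simp add: ev_append pspan_add pspan_scale ac_simps)
qed

lemma br_lwords_pspan:
  assumes "lwords us" "lwords vs"
  shows "br (ev (concat us)) (ev (concat vs) :: 'k::field ser) \<in> pspan (wt (concat us) + wt (concat vs))"
  using assms(1)
proof (induction us)
  case Nil
  then show ?case by (simp add: pspan_zero)
next
  case (Cons u us)
  let ?G = "ev (concat vs) :: 'k ser"
  from Cons.prems obtain xs n where u: "u = xV xs n" "distinct xs" "small xs n"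
    by (auto simp: lwords_def)
  have us: "lwords us" and lu: "lwords [u]"
    using Cons.prems by (auto simp: lwords_def)
  have "br (ev u) ?G \<in> pspan (wt u + wt (concat vs))"
    using br_lword_pspan[OF u(3) assms(2)] u(1) by blast
  then have "br (ev u) ?G \<star> ev (concat us) \<in> pspan (wt u + wt (concat vs) + wt (concat us))"
    using us by (intro mul_pspan ev_in_pspan) auto
  moreover have "ev (concat [u]) \<star> br (ev (concat us)) ?G
      \<in> pspan (wt (concat [u]) + (wt (concat us) + wt (concat vs)))"
    using us lu Cons.IH by (intro mul_pspan ev_in_pspan) auto
  moreover have "br (ev u \<star> ev (concat us)) ?G = ev u \<star> br (ev (concat us)) ?G
      + smul ((-1) ^ (length (concat us) * length (concat vs))) (br (ev u) ?G \<star> ev (concat us))"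
    by (intro br_mul_left[of "length u"] homog_ev tame_ev)
  ultimately show ?case
    by (simp add: ev_append pspan_add pspan_scale ac_simps)
qed

lemma br_pspan:
  fixes f :: "'k::field ser"
  assumes "f \<in> pspan v" "g \<in> pspan w"
  shows "br f g \<in> pspan (v + w)"
proof (rule pspan_image[OF assms(1), where T = "\<lambda>f. br f g"])
  fix us assume us: "lwords us" "wt (concat us) \<le> v"
  show "br (ev (concat us)) g \<in> pspan (v + w)"
  proof (rule pspan_image[OF assms(2), where T = "\<lambda>g. br (ev (concat us)) g"])
    fix vs assume vs: "lwords vs" "wt (concat vs) \<le> w"
    then show "br (ev (concat us)) (ev (concat vs)) \<in> (pspan (v + w) :: 'k ser set)"
      using br_lwords_pspan[OF us(1) vs(1)] us(2)
        pspan_mono[of "wt (concat us) + wt (concat vs)" "v + w"] by auto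
  qed (simp_all add: tame_pspan br_add_right br_smul_right)
qed (use assms(2) in \<open>simp_all add: tame_pspan br_add_left br_smul_left\<close>)

lemma par_sign_pspan:
  fixes f :: "'k::field ser"
  assumes "f \<in> pspan w"
  shows "par_sign f \<in> pspan w"
proof (rule pspan_image[OF assms, where T = par_sign])
  fix us assume "lwords us" "wt (concat us) \<le> w"
  then show "par_sign (ev (concat us)) \<in> (pspan w :: 'k ser set)"
    by (simp only: homog_par_sign[OF homog_ev] pspan_scale ev_in_pspan)
qed (auto simp: par_sign_def ev_part_def od_part_def smul_def fun_eq_iff plus_fun_apply)

text \<open>The generators have weight at most \<open>lam ^ 2\<close>, the unit having weight 0.
  Products and brackets add weights, and \<open>par_sign\<close> only rescales words.\<close>

lemma Jword_pspan:
  assumes "Jword m (u :: 'k::field kan)"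
  shows "kfst u \<in> pspan (lam ^ 2 * m) \<and> ksnd u \<in> pspan (lam ^ 2 * m)"
  using assms
proof (induction rule: Jword.induct)
  case (base u)
  have V: "V i \<in> (pspan (lam ^ 2) :: 'k ser set)" if "i \<le> 2" for i
  proof -
    have "ev (concat [xV [] i]) \<in> (pspan (lam ^ 2) :: 'k ser set)"
      using that lam_gt by (intro ev_in_pspan) (auto simp: lwords_def small_def xV_def)
    then show ?thesis
      by (simp add: xV_def mul_one_right tame_fin_supp)
  qed
  have "one_s \<in> (pspan (lam ^ 2) :: 'k ser set)"
  proof -
    have "ev (concat []) \<in> (pspan (lam ^ 2) :: 'k ser set)"
      by (intro ev_in_pspan) (auto simp: lwords_def)
    then show ?thesis by simp
  qed
  moreover have "(\<lambda>_. 0) \<in> (pspan (lam ^ 2) :: 'k ser set)"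
    using pspan_zero by (simp add: zero_fun_def)
  ultimately show ?case
    using base V[of 0] V[of 1] V[of 2] by (auto simp: Jgens_def)
next
  case (prod m u k v)
  show ?case
    unfolding jprod_comps of_nat_add distrib_left
    using prod by (auto intro!: pspan_add mul_pspan br_pspan par_sign_pspan)
qed

lemma small_weight:
  obtains d where "0 < d" "\<And>xs n. distinct xs \<Longrightarrow> small xs n \<Longrightarrow> d * lam ^ n \<le> wt (xV xs n)"
proof -
  define th where "th = 1 / (lam - 1)"
  \<comment> \<open>The worst word has all of \<open>x\<^sub>0, \<dots>, x\<^sub>n\<^sub>-\<^sub>4\<close> and \<open>x\<^sub>n\<^sub>-\<^sub>2\<close>; by the equation for
    \<open>lam\<close> its weight exceeds \<open>(2 - th) * lam ^ (n - 3)\<close>.\<close>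
  define d where "d = min ((2 - th) / lam ^ 3) (1 / 4)"
  have th: "th < 2"
    using lam_gt by (simp add: th_def field_simps)
  have d: "0 < d"
    using th lam_power_pos[of 3] by (auto simp: d_def simp del: lam_power_pos intro!: divide_pos_pos)
  have "d * lam ^ n \<le> wt (xV xs n)" if xs: "distinct xs" "small xs n" for xs n
  proof -
    have sum: "wt (xV xs n) = lam ^ n - (\<Sum>i\<in>set xs. lam ^ i)"
    proof -
      have "wt (map LX zs) = - sum_list (map ((^) lam) zs)" for zs
        by (induction zs) auto
      then show ?thesis
        using xs(1) by (simp add: xV_def sum_list_distinct_conv_sum_set)
    qed
    \<comment> \<open>The bound 1/4 in \<open>d\<close> serves the case \<open>n \<le> 2\<close>,
      where at most x_0 occurs: \<open>9 / 4 \<le> lam ^ 2\<close> makes \<open>lam ^ 2 - 1\<close>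
      at least \<open>lam ^ 2 / 4\<close>.\<close>
    have d4: "d * lam ^ n \<le> lam ^ n / 4"
    proof -
      have "d \<le> 1 / 4"
        unfolding d_def by (rule min.cobounded2)
      then show ?thesis
        using mult_right_mono[of d "1 / 4" "lam ^ n"] by (simp add: less_imp_le)
    qed
    consider "n \<le> 1" | "n = 2" | "3 \<le> n" by linarith
    then show ?thesis
    proof cases
      case 1
      then have "set xs = {}"
        using xs(2) by (fastforce simp: small_def)
      then show ?thesis
        using d4 lam_power_pos[of n] unfolding sum by (simp del: lam_power_pos)
    next
      case 2
      then have "set xs \<subseteq> {0}"
        using xs(2) by (auto simp: small_def)
      then have "(\<Sum>i\<in>set xs. lam ^ i) \<le> (\<Sum>i\<in>{0}. lam ^ i)"
        by (intro sum_mono2) (auto simp del: power_Suc intro: less_imp_le)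
      moreover have "(3 / 2) ^ 2 \<le> lam ^ 2"
        using lam_gt by (intro power_mono) auto
      ultimately show ?thesis
        using d4 unfolding sum unfolding 2 by (simp add: power2_eq_square)
    next
      case 3
      then obtain k where n: "n = k + 3"
        by (metis le_add_diff_inverse2)
      have le: "lam ^ k \<le> lam ^ (k + 1)"
        using lam_gt by (intro power_increasing) auto
      have "set xs \<subseteq> {..<k} \<union> (set xs \<inter> {k, k + 1})"
        using xs(2) by (auto simp: small_def n)
      then have "(\<Sum>i\<in>set xs. lam ^ i) \<le> (\<Sum>i\<in>{..<k} \<union> (set xs \<inter> {k, k + 1}). lam ^ i)"
        by (intro sum_mono2) (auto simp del: power_Suc intro: less_imp_le)
      also have "\<dots> = (\<Sum>i<k. lam ^ i) + (\<Sum>i\<in>set xs \<inter> {k, k + 1}. lam ^ i)"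
        by (intro sum.union_disjoint) auto
      \<comment> \<open>Here the excluded pair enters: at most one of the two top indices
        \<open>n - 3\<close> and \<open>n - 2\<close> occurs.\<close>
      also have "(\<Sum>i\<in>set xs \<inter> {k, k + 1}. lam ^ i) \<le> lam ^ (k + 1)"
      proof -
        have "set xs \<inter> {k, k + 1} \<subseteq> {k} \<or> set xs \<inter> {k, k + 1} \<subseteq> {k + 1}"
          using xs(2) by (auto simp: small_def n)
        then show ?thesis
        proof
          assume "set xs \<inter> {k, k + 1} \<subseteq> {k}"
          then have "(\<Sum>i\<in>set xs \<inter> {k, k + 1}. lam ^ i) \<le> (\<Sum>i\<in>{k}. lam ^ i)"
            by (intro sum_mono2) (auto simp del: power_Suc intro: less_imp_le)
          also have "\<dots> \<le> lam ^ (k + 1)"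
            using le by (simp del: power_Suc)
          finally show ?thesis .
        next
          assume "set xs \<inter> {k, k + 1} \<subseteq> {k + 1}"
          then have "(\<Sum>i\<in>set xs \<inter> {k, k + 1}. lam ^ i) \<le> (\<Sum>i\<in>{k + 1}. lam ^ i)"
            by (intro sum_mono2) (auto simp del: power_Suc intro: less_imp_le)
          then show ?thesis by simp
        qed
      qed
      also have "(\<Sum>i<k. lam ^ i) = (lam ^ k - 1) * th"
        using lam_gt by (subst geometric_sum) (auto simp: th_def)
      also have "\<dots> \<le> th * lam ^ k"
        using lam_gt by (simp add: th_def divide_right_mono)
      finally have "(\<Sum>i\<in>set xs. lam ^ i) \<le> th * lam ^ k + lam ^ (k + 1)"
        by simp
      moreover have "d * lam ^ n \<le> (2 - th) / lam ^ 3 * lam ^ n"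
        by (intro mult_right_mono) (auto simp: d_def intro: less_imp_le)
      moreover have "(2 - th) / lam ^ 3 * lam ^ n = (2 - th) * lam ^ k"
        using lam_power_pos[of 3] by (simp add: n power_add del: lam_power_pos)
      ultimately show ?thesis
        using lam_rec[of k] unfolding sum unfolding n by (simp add: algebra_simps)
    qed
  qed
  with d show thesis by (rule that)
qed

end

section \<open>Spans of the products of finitely many letters\<close>

primrec pbasis :: "letter list \<Rightarrow> 'k::field ser set" where
  "pbasis [] = {one_s}"
| "pbasis (a # as) = pbasis as \<union> (\<lambda>f. val a \<star> f) ` pbasis as"

lemma finite_pbasis [simp]: "finite (pbasis as)"
  by (induction as) auto

lemma card_pbasis: "card (pbasis as :: 'k::field ser set) \<le> 2 ^ length as"
proof (induction as)
  case (Cons a as)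
  have "card (pbasis (a # as) :: 'k ser set)
      \<le> card (pbasis as :: 'k ser set) + card ((\<lambda>f. val a \<star> f) ` pbasis as :: 'k ser set)"
    by (simp add: card_Un_le)
  also have "card ((\<lambda>f. val a \<star> f) ` pbasis as :: 'k ser set) \<le> card (pbasis as :: 'k ser set)"
    by (intro card_image_le) simp
  finally show ?case using Cons by simp
qed simp

lemma val_val_anticommute: "val a \<star> (val b \<star> g) = smul (-1) (val b \<star> (val a \<star> g))"
proof -
  have "val a \<star> val b = smul (-1) (val b \<star> val a)"
    using mul_commute[OF homog_val homog_val] by simp
  then show ?thesis by (metis mul_assoc mul_smul_left)
qed

text \<open>The letter is moved past the head of the list by anticommutation, or is absorbed when it
  equals the head, since squares vanish.\<close>

lemma val_mul_pbasis:
  "a \<in> set as \<Longrightarrow> f \<in> ser.span (pbasis as) \<Longrightarrow> val a \<star> f \<in> ser.span (pbasis as :: 'k::field ser set)"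
proof (induction as arbitrary: f)
  case (Cons b as)
  have sub: "ser.span (pbasis as) \<subseteq> ser.span (pbasis (b # as) :: 'k ser set)"
    by (rule ser.span_mono) auto
  have b_span: "val b \<star> g \<in> ser.span (pbasis (b # as))" if "g \<in> ser.span (pbasis as)" for g :: "'k ser"
    by (rule span_image[OF that, where T = "\<lambda>g. val b \<star> g"])
      (auto simp: mul_add_right mul_smul_right intro: ser.span_base)
  show ?case
  proof (rule span_image[OF Cons.prems(2), where T = "\<lambda>f. val a \<star> f"])
    fix g :: "'k ser" assume "g \<in> pbasis (b # as)"
    then consider "g \<in> pbasis as" | h where "g = val b \<star> h" "h \<in> pbasis as" by auto
    then show "val a \<star> g \<in> ser.span (pbasis (b # as))"
    proof cases
      case 1
      then show ?thesis
        using Cons b_span sub by (cases "a = b") (auto intro: ser.span_base)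
    next
      case 2
      show ?thesis
      proof (cases "a = b")
        case True
        then have "val a \<star> g = 0"
          by (simp add: 2 val_square flip: mul_assoc)
        then show ?thesis by (simp add: ser.span_zero)
      next
        case False
        then have "val a \<star> h \<in> ser.span (pbasis as)"
          using Cons 2 by (auto intro: ser.span_base)
        then show ?thesis
          unfolding 2(1) val_val_anticommute[of a b] by (intro ser.span_scale b_span)
      qed
    qed
  qed (simp_all add: mul_add_right mul_smul_right)
qed simp

lemma ev_in_pbasis: "set w \<subseteq> set as \<Longrightarrow> ev w \<in> ser.span (pbasis as :: 'k::field ser set)"
proof (induction w)
  case Nil
  have "one_s \<in> (pbasis as :: 'k ser set)"
    by (induction as) auto
  then show ?case by (simp add: ser.span_base)
qed (auto intro: val_mul_pbasis)

interpretation kan: vector_space kscale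
  by standard (auto simp: kscale_def algebra_simps plus_fun_apply)

lemma kpair_linear:
  "kpair (a + b) c = kpair a 0 + kpair b c" "kpair 0 (a + b) = kpair 0 a + kpair 0 b"
  "kpair (smul r a) 0 = kscale r (kpair a 0)" "kpair 0 (smul r a) = kscale r (kpair 0 a)"
  by (auto simp: fun_eq_iff kpair_def kscale_def smul_def zero_fun_apply plus_fun_apply)

lemma kpair_zero: "kpair 0 0 = 0"
  by (auto simp: fun_eq_iff kpair_def zero_fun_apply)

lemma kpair_split: "kpair a b = kpair a 0 + kpair 0 b"
  by (auto simp: fun_eq_iff kpair_def zero_fun_apply plus_fun_apply)

text \<open>The Kantor double consists of two copies of the series, so a spanning set at most
  doubles in size.\<close>

lemma kpair_span:
  assumes "a \<in> ser.span B" "b \<in> ser.span B"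
  shows "kpair a b \<in> kan.span ((\<lambda>f. kpair f 0) ` B \<union> (\<lambda>f. kpair 0 f) ` B)"
    (is "_ \<in> kan.span ?C")
proof -
  have "kpair a 0 \<in> kan.span ?C"
    using assms(1)
  proof (induction rule: ser.span_induct_alt)
    case base
    then show ?case by (simp only: kpair_zero kan.span_zero)
  next
    case (step c x y)
    then have "kpair x 0 \<in> ?C"
      by auto
    then show ?case
      using step by (simp only: kpair_linear kan.span_add kan.span_scale kan.span_base)
  qed
  moreover have "kpair 0 b \<in> kan.span ?C"
    using assms(2)
  proof (induction rule: ser.span_induct_alt)
    case base
    then show ?case by (simp only: kpair_zero kan.span_zero)
  next
    case (step c x y)
    then have "kpair 0 x \<in> ?C"
      by auto
    then show ?case
      using step by (simp only: kpair_linear kan.span_add kan.span_scale kan.span_base)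
  qed
  ultimately show ?thesis
    by (subst kpair_split) (rule kan.span_add)
qed

context growth_rate
begin

text \<open>All factors have nonnegative weight, so each one has weight at most \<open>w\<close>.
  The lower bound on weights then forces its V-index below \<open>N\<close>, and smallness does the
  same for its x-indices.\<close>

lemma pspan_pbasis:
  assumes d: "0 < d" "\<And>xs n. distinct xs \<Longrightarrow> small xs n \<Longrightarrow> d * lam ^ n \<le> wt (xV xs n)"
    and N: "w < d * lam ^ N"
  shows "pspan w \<subseteq> ser.span (pbasis (map LX [0..<N] @ map LV [0..<N]) :: 'k::field ser set)"
  unfolding pspan_def
proof (rule ser.span_minimal[OF subsetI ser.subspace_span])
  fix f :: "'k ser" assume "f \<in> {ev (concat us) | us. lwords us \<and> wt (concat us) \<le> w}"
  then obtain us where us: "f = ev (concat us)" "lwords us" "wt (concat us) \<le> w"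
    by blast
  have nonneg: "0 \<le> wt u" if u_in: "u \<in> set us" for u
  proof -
    obtain xs n where u: "u = xV xs n" "distinct xs" "small xs n"
      using us(2) u_in unfolding lwords_def by blast
    then have "d * lam ^ n \<le> wt u"
      using d(2) by simp
    moreover have "0 \<le> d * lam ^ n"
      using d(1) by (simp add: less_imp_le)
    ultimately show ?thesis by linarith
  qed
  have wt_concat: "wt (concat us') = sum_list (map wt us')" for us'
    by (induction us') auto
  have "set u \<subseteq> set (map LX [0..<N] @ map LV [0..<N])" if u_in: "u \<in> set us" for u
  proof -
    obtain xs n where u: "u = xV xs n" "distinct xs" "small xs n"
      using us(2) u_in unfolding lwords_def by blast
    have "d * lam ^ n \<le> wt u"
      using d(2) u by simp
    also have "wt u \<le> wt (concat us)"
      unfolding wt_concat using u_in nonneg by (intro member_le_sum_list) auto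
    also have "\<dots> < d * lam ^ N"
      using us(3) N by linarith
    finally have "lam ^ n < lam ^ N"
      using d(1) by simp
    then have "n < N"
      using lam_gt by (simp add: power_strict_increasing_iff)
    then show ?thesis
      using u(3) by (auto simp: u(1) xV_def small_def)
  qed
  then show "f \<in> ser.span (pbasis (map LX [0..<N] @ map LV [0..<N]))"
    unfolding us(1) by (intro ev_in_pbasis) auto
qed

lemma Jwords_span:
  obtains d where "0 < d"
    "\<And>n N. lam ^ 2 * real n < d * lam ^ N \<Longrightarrow> \<exists>W :: 'k::field kan set.
      finite W \<and> card W \<le> 2 * 4 ^ N \<and> {u. \<exists>m. 1 \<le> m \<and> m \<le> n \<and> Jword m u} \<subseteq> kan.span W"
proof -
  obtain d where d: "0 < d" "\<And>xs n. distinct xs \<Longrightarrow> small xs n \<Longrightarrow> d * lam ^ n \<le> wt (xV xs n)"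
    by (rule small_weight) blast
  have "\<exists>W :: 'k kan set. finite W \<and> card W \<le> 2 * 4 ^ N \<and>
      {u. \<exists>m. 1 \<le> m \<and> m \<le> n \<and> Jword m u} \<subseteq> kan.span W"
    if N: "lam ^ 2 * real n < d * lam ^ N" for n N
  proof -
    define B :: "'k ser set" where "B = pbasis (map LX [0..<N] @ map LV [0..<N])"
    have fin: "finite B"
      by (simp add: B_def)
    have cB: "card B \<le> 4 ^ N"
      \<comment> \<open>There are \<open>2 * N\<close> letters, hence at most
        \<open>2 ^ (2 * N)\<close> products of them.\<close>
      using card_pbasis[of "map LX [0..<N] @ map LV [0..<N]", where 'k='k]
      by (simp add: B_def power_add flip: power_mult_distrib)
    let ?W = "(\<lambda>f. kpair f 0) ` B \<union> (\<lambda>f. kpair 0 f) ` B"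
    have "card ?W \<le> card ((\<lambda>f. kpair f 0) ` B) + card ((\<lambda>f. kpair 0 f) ` B)"
      by (rule card_Un_le)
    also have "\<dots> \<le> card B + card B"
      by (intro add_mono card_image_le fin)
    finally have "card ?W \<le> 2 * 4 ^ N"
      using cB by simp
    moreover have "u \<in> kan.span ?W" if "1 \<le> m" "m \<le> n" "Jword m u" for m and u :: "'k kan"
    proof -
      have "lam ^ 2 * m \<le> lam ^ 2 * n"
        using that by (intro mult_left_mono) auto
      then have "pspan (lam ^ 2 * m) \<subseteq> (ser.span B :: 'k ser set)"
        unfolding B_def using N by (intro pspan_pbasis[OF d]) auto
      then have "kpair (kfst u) (ksnd u) \<in> kan.span ?W"
        using Jword_pspan[OF that(3)] by (intro kpair_span) auto
      then show ?thesis by (simp add: kpair_eta)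
    qed
    ultimately show ?thesis
      using fin by (intro exI[of _ ?W]) auto
  qed
  with d(1) show thesis by (rule that)
qed

end

section \<open>Leading monomials\<close>

lemma mul_uminus [simp]: "f \<star> - g = - (f \<star> g)" "- f \<star> g = - (f \<star> g)"
  using mul_smul_right[of f "-1" g] mul_smul_left[of "-1" f g] by simp_all

definition ysum :: "nat set \<Rightarrow> nat" where
  "ysum S = (\<Sum>c | c \<in> S \<and> even c. c)"

lemma ysum_Un:
  assumes "finite S" "finite T" "S \<inter> T = {}"
  shows "ysum (S \<union> T) = ysum S + ysum T"
proof -
  have "{c. c \<in> S \<union> T \<and> even c} = {c. c \<in> S \<and> even c} \<union> {c. c \<in> T \<and> even c}"
    by auto
  then show ?thesis
    unfolding ysum_def using assms by (simp only:) (intro sum.union_disjoint, auto)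
qed

text \<open>Every monomial of \<open>V\<^sub>n\<close> other than \<open>y\<^sub>n\<close> contains a \<open>y\<close> of larger index, so comparing the sums
  of the \<open>y\<close>-codes singles out the monomial obtained from a word by replacing \<open>V\<close> by \<open>y\<close>.\<close>

definition leads :: "nat set \<Rightarrow> 'k::field ser \<Rightarrow> bool" where
  "leads S f \<longleftrightarrow> finite S \<and> f S \<noteq> 0 \<and> (\<forall>T. f T \<noteq> 0 \<longrightarrow> finite T \<and> (T = S \<or> ysum S < ysum T))"

lemma leadsD: "leads S f \<Longrightarrow> f T \<noteq> 0 \<Longrightarrow> finite T \<and> (T = S \<or> ysum S < ysum T)"
  by (simp add: leads_def)

text \<open>\<open>ysum\<close> is additive on disjoint monomials, so the two leading monomials form
  the only pair contributing at \<open>S \<union> T\<close>, and nothing cancels there.\<close>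

lemma leads_mul:
  fixes f g :: "'k::field ser"
  assumes f: "leads S f" and g: "leads T g" and disj: "S \<inter> T = {}"
  shows "leads (S \<union> T) (f \<star> g)"
proof -
  have fin: "finite S" "finite T"
    using f g by (auto simp: leads_def)
  have eq: "(A = S \<and> B = T) \<or> ysum (S \<union> T) < ysum (A \<union> B)"
    if "f A \<noteq> 0" "g B \<noteq> 0" "A \<inter> B = {}" for A B
    using leadsD[OF f that(1)] leadsD[OF g that(2)] that(3) fin disj by (auto simp: ysum_Un)
  have "(f \<star> g) (S \<union> T) = (\<Sum>A\<in>Pow (S \<union> T). if A = S then sgnp S T * f S * g T else 0)"
    unfolding mul_def
  proof (intro sum.cong refl)
    fix A assume "A \<in> Pow (S \<union> T)"
    then have AB: "A \<union> (S \<union> T - A) = S \<union> T" "A \<inter> (S \<union> T - A) = {}"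
      by auto
    show "sgnp A (S \<union> T - A) * f A * g (S \<union> T - A) = (if A = S then sgnp S T * f S * g T else 0)"
    proof (cases "A = S")
      case True
      moreover have "S \<union> T - S = T"
        using disj by auto
      ultimately show ?thesis by simp
    next
      case False
      then have "f A = 0 \<or> g (S \<union> T - A) = 0"
        using eq[of A "S \<union> T - A"] AB by auto
      then show ?thesis using False by auto
    qed
  qed
  also have "\<dots> = sgnp S T * f S * g T"
    using fin by simp
  also have "\<dots> \<noteq> 0"
    using f g by (simp add: leads_def sgnp_def)
  finally have "(f \<star> g) (S \<union> T) \<noteq> 0" .
  moreover have "finite U \<and> (U = S \<union> T \<or> ysum (S \<union> T) < ysum U)" if "(f \<star> g) U \<noteq> 0" for U
    using that
  proof (rule mul_supportE)
    fix A B assume "finite U" "U = A \<union> B" "A \<inter> B = {}" "f A \<noteq> 0" "g B \<noteq> 0"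
    then show ?thesis using eq[of A B] by auto
  qed
  ultimately show ?thesis
    using fin by (simp add: leads_def)
qed

lemma leads_smul: "leads S f \<Longrightarrow> c \<noteq> 0 \<Longrightarrow> leads S (smul c f)"
  by (simp add: leads_def smul_def)

primrec code :: "letter \<Rightarrow> nat" where
  "code (LX i) = xcode i"
| "code (LV n) = ycode n"

lemma inj_code: "inj code"
proof (rule injI)
  fix a b assume "code a = code b"
  then show "a = b" by (cases a; cases b) auto
qed

text \<open>The term \<open>k = 0\<close> of V_n is y_n. Every later term contains y_(n+3k), whose
  code alone exceeds that of y_n.\<close>

lemma leads_val: "leads {code a} (val a :: 'k::field ser)"
proof (cases a)
  case (LX i)
  then show ?thesis by (auto simp: leads_def xg_def gen_def)
next
  case (LV n)
  have "(xg n \<star> xg (n + 1)) T \<noteq> (0::'k) \<Longrightarrow> xcode n \<in> T" for T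
    by (erule mul_supportE) (auto simp: xg_def gen_def split: if_splits)
  then have "((xg n \<star> xg (n + 1)) \<star> V (n + 3)) {ycode n} = (0::'k)"
    by (metis (no_types, lifting) UnI1 mul_supportE singletonD xcode_ycode_simps(1))
  then have V1: "V n {ycode n} = (1::'k)"
    by (subst V_rec) (simp add: plus_fun_apply yg_def gen_def)
  have "finite T \<and> (T = {ycode n} \<or> ysum {ycode n} < ysum T)" if VT: "V n T \<noteq> (0::'k)" for T
  proof -
    obtain k where k: "Vterm n k T \<noteq> (0::'k)"
      using VT by (rule V_supportE)
    show ?thesis
    proof (cases k)
      case 0
      then show ?thesis using k by (auto simp: yg_def gen_def split: if_splits)
    next
      case (Suc l)
      have T: "finite T" "2 * (n + 3 * k) \<in> T"
        using Vterm_support[OF k] by auto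
      have "ysum {ycode n} = 2 * n"
      proof -
        have "{c. c \<in> {ycode n} \<and> even c} = {2 * n}"
          by (auto simp: ycode_def)
        then show ?thesis by (simp only: ysum_def) simp
      qed
      also have "\<dots> < 2 * (n + 3 * k)"
        using Suc by simp
      also have "\<dots> \<le> ysum T"
        unfolding ysum_def using T by (intro member_le_sum) auto
      finally show ?thesis using T by simp
    qed
  qed
  then show ?thesis
    using V1 LV by (simp add: leads_def)
qed

lemma leads_ev: "distinct w \<Longrightarrow> leads (code ` set w) (ev w :: 'k::field ser)"
proof (induction w)
  case Nil
  show ?case by (auto simp: leads_def one_s_def)
next
  case (Cons a w)
  then have "leads ({code a} \<union> code ` set w) (val a \<star> ev w :: 'k ser)"
    using inj_code by (intro leads_mul leads_val) (auto dest: injD)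
  then show ?case by simp
qed

lemma leads_unique:
  assumes "leads S f" "leads T f"
  shows "S = T"
proof -
  have "f S \<noteq> 0" "f T \<noteq> 0"
    using assms by (simp_all add: leads_def)
  then show ?thesis
    using leadsD[OF assms(1), of T] leadsD[OF assms(2), of S] by auto
qed

lemma leads_independent:
  fixes f :: "nat set \<Rightarrow> 'k::field ser"
  assumes f: "\<And>S. S \<in> I \<Longrightarrow> leads S (f S)"
  shows "inj_on (\<lambda>S. kpair (f S) 0) I" "kan.independent ((\<lambda>S. kpair (f S) 0) ` I)"
proof -
  let ?g = "\<lambda>S. kpair (f S) 0"
  show inj: "inj_on ?g I"
  proof (rule inj_onI)
    fix S T assume ST: "S \<in> I" "T \<in> I" "?g S = ?g T"
    then have "f S = f T" by (metis kpair_comps(1))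
    then show "S = T" using f[OF ST(1)] f[OF ST(2)] leads_unique by metis
  qed
  show "kan.independent (?g ` I)"
  proof
    assume "kan.dependent (?g ` I)"
    then obtain t u where t: "finite t" "t \<subseteq> ?g ` I" "\<exists>v\<in>t. u v \<noteq> 0" "(\<Sum>v\<in>t. kscale (u v) v) = 0"
      unfolding kan.dependent_explicit by blast
    obtain J where J: "J \<subseteq> I" "finite J" "t = ?g ` J"
      using finite_subset_image[OF t(1,2)] by blast
    define K where "K = {S \<in> J. u (?g S) \<noteq> 0}"
    have "K \<noteq> {}" "finite K"
      using t(3) J by (auto simp: K_def)
    \<comment> \<open>Among the indices with nonzero coefficient, one of least \<open>ysum\<close>
      is chosen. No other element of the combination has a coefficient at this monomial.\<close>
    then obtain S0 where S0: "S0 \<in> K" "\<And>S. S \<in> K \<Longrightarrow> ysum S0 \<le> ysum S"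
      using ex_min_if_finite[of "ysum ` K"] by (metis (no_types, lifting) finite_imageI image_iff image_is_empty not_le)
    have "0 = (\<Sum>v\<in>t. kscale (u v) v) (False, S0)"
      by (simp add: t(4) zero_fun_apply)
    also have "\<dots> = (\<Sum>v\<in>t. u v * v (False, S0))"
      by (simp add: sum_ser_apply kscale_def)
    also have "\<dots> = (\<Sum>S\<in>J. u (?g S) * f S S0)"
      unfolding J(3) using inj J(1) by (subst sum.reindex) (auto simp: inj_on_subset kpair_def)
    also have "\<dots> = (\<Sum>S\<in>J. if S = S0 then u (?g S0) * f S0 S0 else 0)"
    proof (intro sum.cong refl)
      fix S assume S: "S \<in> J"
      show "u (?g S) * f S S0 = (if S = S0 then u (?g S0) * f S0 S0 else 0)"
      proof (cases "S = S0 \<or> u (?g S) = 0")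
        case True
        then show ?thesis using S0(1) by (auto simp: K_def)
      next
        case False
        then have "ysum S0 \<le> ysum S"
          using S S0(2) by (auto simp: K_def)
        then have "f S S0 = 0"
          using leadsD[OF f, of S S0] S J(1) False by (metis in_mono not_le)
        then show ?thesis using False by auto
      qed
    qed
    also have "\<dots> = u (?g S0) * f S0 S0"
      using S0(1) J(2) by (auto simp: K_def)
    finally show False
      using S0(1) J(1) f[of S0] by (auto simp: K_def leads_def)
  qed
qed

section \<open>The lower bound\<close>

lemma parts_zero [simp]: "od_part 0 = 0" "ev_part 0 = 0"
  by (simp_all add: od_part_def ev_part_def fun_eq_iff zero_fun_apply)

lemma br_zero_left [simp]: "br 0 g = 0"
  by (rule ext) (simp add: br_def br_hom_fun zero_fun_apply)

lemma par_sign_zero [simp]: "par_sign 0 = 0"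
  by (rule ext) (simp add: par_sign_def zero_fun_apply)

lemma par_sign_par_sign [simp]: "par_sign (par_sign f) = f"
  by (auto simp: par_sign_def od_part_def ev_part_def)

lemma fin_supp_par_sign: "fin_supp f \<Longrightarrow> fin_supp (par_sign f)"
  by (auto simp: fin_supp_def par_sign_def od_part_def ev_part_def split: if_splits)

lemma kpair_eqI: "kfst u = a \<Longrightarrow> ksnd u = b \<Longrightarrow> u = kpair a b"
  by (metis kpair_eta)

text \<open>Multiplication by the generator \<open>kpair 0 one_s\<close> moves a series to the
  barred half, where the Jordan product is the bracket. So a bracket costs two extra
  factors.\<close>

lemma jprod_kpair:
  "jprod (kpair a 0) (kpair b 0) = kpair (a \<star> b) 0"
  "fin_supp a \<Longrightarrow> jprod (kpair a 0) (kpair 0 one_s) = kpair 0 a"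
  "fin_supp b \<Longrightarrow> jprod (kpair 0 one_s) (kpair b 0) = kpair 0 (par_sign b)"
  "jprod (kpair 0 a) (kpair 0 b) = kpair (br a (par_sign b)) 0"
  by (rule kpair_eqI; simp add: jprod_comps mul_one_left mul_one_right fin_supp_par_sign)+

lemma Jword_ge_1: "Jword m u \<Longrightarrow> 1 \<le> m"
  by (induction rule: Jword.induct) auto

section \<open>Removing a factor x_i by bracketing with V_i\<close>

lemma x_sandwich: "xg i \<star> (h \<star> (xg i \<star> g)) = (0 :: 'k::field ser)"
proof (rule ext, rule ccontr)
  fix S assume "(xg i \<star> (h \<star> (xg i \<star> g))) S \<noteq> (0 S :: 'k)"
  then have "(xg i \<star> (h \<star> (xg i \<star> g))) S \<noteq> (0 :: 'k)"
    by (simp add: zero_fun_apply)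
  then obtain A B where A: "A \<inter> B = {}" "xg i A \<noteq> (0::'k)" "(h \<star> (xg i \<star> g)) B \<noteq> (0::'k)"
    by (rule mul_supportE)
  from A(3) obtain C D where C: "B = C \<union> D" "(xg i \<star> g) D \<noteq> (0::'k)"
    by (rule mul_supportE)
  from C(2) obtain E F where E: "D = E \<union> F" "xg i E \<noteq> (0::'k)"
    by (rule mul_supportE)
  show False
    using A(1,2) C(1) E by (auto simp: xg_def gen_def split: if_splits)
qed

text \<open>For \<open>j \<noteq> i\<close> every monomial in the derivative of V_i by y_j contains
  x_i. The factor serves to make the unwanted Leibniz terms vanish when a word contains x_i.\<close>

lemma br_V_xword_factor:
  assumes "i \<notin> set q"
  obtains h where "br (V i) (ev (map LX q)) = (xg i \<star> h :: 'k::field ser)"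
proof -
  have "\<exists>h. br (V i) (ev (map LX q)) = (xg i \<star> h :: 'k ser)"
    using assms
  proof (induction q)
    case Nil
    then show ?case by (intro exI[of _ 0]) simp
  next
    case (Cons j q)
    then obtain h where h: "br (V i) (ev (map LX q)) = (xg i \<star> h :: 'k ser)"
      by auto
    have "br (V i) (ev (map LX (j # q))) = (br (V i) (xg j) \<star> ev (map LX q)
        + smul (-1) (xg j \<star> br (V i) (ev (map LX q))) :: 'k ser)"
      using br_mul_right[OF homog_V homog_xy(1), of i j "ev (map LX q) :: 'k ser"] by simp
    also have "br (V i) (xg j) = xg i \<star> (xg (i + 1) \<star> deriv_s (ycode j) (V (i + 3)) :: 'k ser)"
      using Cons.prems by (simp only: br_V_x) (subst deriv_y_V_rec, auto simp: mul_assoc)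
    also have "smul (-1) (xg j \<star> br (V i) (ev (map LX q))) = xg i \<star> (xg j \<star> h)"
      using val_val_anticommute[of "LX i" "LX j" h] by (simp add: h)
    finally have "br (V i) (ev (map LX (j # q))) =
        xg i \<star> ((xg (i + 1) \<star> deriv_s (ycode j) (V (i + 3))) \<star> ev (map LX q) + xg j \<star> h)"
      by (simp only: mul_add_right mul_assoc)
    then show ?case by blast
  qed
  then show thesis using that by blast
qed

lemma br_V_V_factor:
  assumes "i < n"
  obtains h where "br (V i) (V n) = (xg i \<star> h :: 'k::field ser)"
proof (cases "n = i + 1")
  case True
  then show thesis
    using that[of "smul (-1) (V (i + 3))"] br_V_V_Suc[of i, where 'a='k] by (simp add: mul_smul_right)
next
  case False
  then show thesis
    using that[of "xg (i + 1) \<star> br (V (i + 3)) (V n)"] assms br_V_V_far[of i n, where 'a='k]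
    by (simp add: mul_assoc)
qed

text \<open>In the Leibniz expansion V_i meets x_i in exactly one term, and that bracket is 1. All
  other terms contain x_i twice and vanish; the sign comes from passing \<open>as\<close>.\<close>

lemma br_V_remove:
  assumes "distinct (as @ i # bs)" "i < n"
  shows "br (V i) (ev (xV (as @ i # bs) n)) = (smul ((-1) ^ length as) (ev (xV (as @ bs) n)) :: 'k::field ser)"
proof -
  let ?a = "ev (map LX as) :: 'k ser" and ?b = "ev (map LX bs @ [LV n]) :: 'k ser"
  have b: "?b = ev (map LX bs) \<star> V n"
    by (simp add: ev_append mul_one_right tame_fin_supp)
  obtain h where h: "br (V i) ?a = xg i \<star> h"
    using assms(1) by (auto intro: br_V_xword_factor[of i as])
  obtain h' where h': "br (V i) (ev (map LX bs)) = (xg i \<star> h' :: 'k ser)"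
    using assms(1) by (auto intro: br_V_xword_factor[of i bs])
  obtain k where k: "br (V i) (V n) = (xg i \<star> k :: 'k ser)"
    using assms(2) by (rule br_V_V_factor)
  have "br (V i) ?b = (xg i \<star> h') \<star> V n + smul ((-1) ^ (Suc 0 * length (map LX bs))) (ev (map LX bs) \<star> (xg i \<star> k))"
    unfolding b by (subst br_mul_right[OF homog_V homog_ev]) (auto simp: h' k)
  then have xb: "xg i \<star> br (V i) ?b = 0"
    by (simp add: mul_add_right mul_smul_right x_sandwich mul_assoc)
  have "br (V i) (xg i \<star> ?b) = br (V i) (xg i) \<star> ?b + smul ((-1) ^ (Suc 0 * Suc 0)) (xg i \<star> br (V i) ?b)"
    by (intro br_mul_right) auto
  also have "\<dots> = ?b"
    by (simp only: br_V_x deriv_y_V_self xb) (simp add: mul_one_left tame_fin_supp)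
  finally have 1: "br (V i) (xg i \<star> ?b) = ?b" .
  have "br (V i) (ev (xV (as @ i # bs) n)) = br (V i) (?a \<star> (xg i \<star> ?b))"
    by (simp add: xV_def ev_append)
  also have "\<dots> = br (V i) ?a \<star> (xg i \<star> ?b) + smul ((-1) ^ (Suc 0 * length (map LX as))) (?a \<star> br (V i) (xg i \<star> ?b))"
    by (intro br_mul_right homog_ev) auto
  also have "\<dots> = smul ((-1) ^ length as) (ev (xV (as @ bs) n))"
    unfolding 1 h by (simp add: mul_assoc x_sandwich xV_def ev_append)
  finally show ?thesis .
qed

context growth_rate
begin

text \<open>A word of weight \<open>w\<close> has at most \<open>w\<close> letters, and each bracket costs two further factors
  \<open>kpair 0 one_s\<close> in a Jordan word; the summand \<open>- 2\<close> absorbs those of the next bracket.\<close>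

definition reach :: "real \<Rightarrow> 'k::field ser \<Rightarrow> bool" where
  "reach w f \<longleftrightarrow> (\<exists>c m. c \<noteq> 0 \<and> real m \<le> 3 * w - 2 \<and> Jword m (kpair (smul c f) 0))"

lemma reach_mul:
  assumes "reach v f" "reach w g"
  shows "reach (v + w) (f \<star> g :: 'k::field ser)"
proof -
  obtain c m d k where 1: "c \<noteq> 0" "real m \<le> 3 * v - 2" "Jword m (kpair (smul c f) 0)"
    and 2: "d \<noteq> 0" "real k \<le> 3 * w - 2" "Jword k (kpair (smul d g) 0)"
    using assms unfolding reach_def by blast
  have "Jword (m + k) (kpair (smul (c * d) (f \<star> g)) 0)"
    using Jword.prod[OF 1(3) 2(3)]
    by (simp add: jprod_kpair mul_smul_left mul_smul_right smul_smul mult.commute)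
  moreover have "real (m + k) \<le> 3 * (v + w) - 2"
    using 1(2) 2(2) by simp
  ultimately show ?thesis
    using 1(1) 2(1) unfolding reach_def by (intro exI[of _ "c * d"] exI[of _ "m + k"]) auto
qed

lemma reach_br:
  assumes "reach v f" "reach w g" "tame f" "tame g"
  shows "reach (v + w) (br f g :: 'k::field ser)"
proof -
  obtain c m d k where 1: "c \<noteq> 0" "real m \<le> 3 * v - 2" "Jword m (kpair (smul c f) 0)"
    and 2: "d \<noteq> 0" "real k \<le> 3 * w - 2" "Jword k (kpair (smul d g) 0)"
    using assms(1,2) unfolding reach_def by blast
  have unit: "Jword 1 (kpair 0 one_s :: 'k kan)"
    by (rule Jword.base) (simp add: Jgens_def zero_fun_def)
  have fin: "fin_supp (smul c f)" "fin_supp (smul d g)"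
    using assms by (auto intro!: tame_fin_supp)
  have "Jword (m + 1) (kpair 0 (smul c f))"
    using Jword.prod[OF 1(3) unit] by (simp add: jprod_kpair fin)
  \<comment> \<open>The unit stands on the left here, so that the sign twist it produces cancels the
    twist in the product of two barred elements.\<close>
  moreover have "Jword (1 + k) (kpair 0 (par_sign (smul d g)))"
    using Jword.prod[OF unit 2(3)] by (simp add: jprod_kpair fin)
  ultimately have "Jword ((m + 1) + (1 + k)) (kpair (br (smul c f) (smul d g)) 0)"
    using Jword.prod by (metis jprod_kpair(4) par_sign_par_sign)
  then have "Jword ((m + 1) + (1 + k)) (kpair (smul (c * d) (br f g)) 0)"
    using assms by (simp add: br_smul_left br_smul_right smul_smul mult.commute)
  moreover have "real ((m + 1) + (1 + k)) \<le> 3 * (v + w) - 2"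
    using 1(2) 2(2) by simp
  ultimately show ?thesis
    using 1(1) 2(1) unfolding reach_def by (intro exI[of _ "c * d"] exI) auto
qed

lemma reach_smul: "reach w (smul d f) \<Longrightarrow> d \<noteq> 0 \<Longrightarrow> reach w f"
  unfolding reach_def smul_smul by (metis no_zero_divisors)

lemma reach_br_smul:
  assumes "reach v f" "reach w g" "tame f" "tame g" "br f g = smul c h" "c \<noteq> 0" "u = v + w"
  shows "reach u h"
  using reach_br[OF assms(1-4)] assms(5-7) reach_smul by metis

lemma ev_xV_Nil: "ev (xV [] n) = V n"
  by (simp add: xV_def mul_one_right tame_fin_supp)

text \<open>The bracket of V_k and V_(k+1) is -x_k V_(k+3), and bracketing with V_k once more
  removes x_k. The weight used, \<open>2 * lam ^ k + lam ^ (k + 1)\<close>, is exactly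
  \<open>lam ^ (k + 3)\<close>.\<close>

lemma reach_V: "reach (lam ^ n) (V n :: 'k::field ser)"
proof (induction n rule: less_induct)
  case (less n)
  show ?case
  proof (cases "n < 3")
    case True
    then have "kpair (V n) 0 \<in> (Jgens :: 'k kan set)"
      by (auto simp: Jgens_def zero_fun_def less_Suc_eq numeral_3_eq_3 numeral_2_eq_2)
    then have "Jword 1 (kpair (smul 1 (V n)) 0 :: 'k kan)"
      by (simp only: smul_one Jword.base)
    moreover have "1 \<le> lam ^ n"
      using lam_gt by (intro one_le_power) auto
    ultimately show ?thesis
      unfolding reach_def by (intro exI[of _ 1] exI[of _ "1::nat"]) auto
  next
    case False
    then obtain k where n: "n = k + 3"
      by (metis le_add_diff_inverse2 not_less)
    have k: "reach (lam ^ k) (V k :: 'k ser)" and k1: "reach (lam ^ (k + 1)) (V (k + 1) :: 'k ser)"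
      using less[of k] less[of "k + 1"] by (simp_all add: n)
    have br: "br (V k) (V (k + 1)) = (smul (-1) (ev (xV ([] @ k # []) n)) :: 'k ser)"
      by (simp only: br_V_V_Suc) (simp add: xV_def n mul_one_right tame_fin_supp)
    have "reach (lam ^ k + lam ^ (k + 1)) (ev (xV ([] @ k # []) n) :: 'k ser)"
      by (intro reach_br_smul[OF k k1 _ _ br]) auto
    from reach_br_smul[OF k this _ _ br_V_remove, of "lam ^ n"]
    have "reach (lam ^ n) (ev (xV ([] @ []) n) :: 'k ser)"
      using lam_rec[of k] by (simp add: n)
    then show ?thesis by (simp add: ev_xV_Nil)
  qed
qed

text \<open>Removing x_i raises the weight of the word by \<open>lam ^ i\<close>, which is precisely
  the weight of the V_i spent.\<close>

lemma reach_remove: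
  assumes "reach (wt (xV (as @ i # bs) n)) (ev (xV (as @ i # bs) n) :: 'k::field ser)"
    "distinct (as @ i # bs)" "i < n"
  shows "reach (wt (xV (as @ bs) n)) (ev (xV (as @ bs) n) :: 'k ser)"
  by (rule reach_br_smul[OF reach_V assms(1) _ _ br_V_remove[OF assms(2,3)]]) (auto simp: xV_def)

lemma reach_filter:
  assumes "finite R" "reach (wt (xV xs n)) (ev (xV xs n) :: 'k::field ser)" "distinct xs" "\<forall>i\<in>set xs. i < n"
  shows "reach (wt (xV (filter (\<lambda>i. i \<notin> R) xs) n)) (ev (xV (filter (\<lambda>i. i \<notin> R) xs) n) :: 'k ser)"
  using assms(1)
proof (induction R rule: finite_induct)
  case empty
  then show ?case using assms(2) by simp
next
  case (insert i R)
  let ?xs = "filter (\<lambda>i. i \<notin> R) xs"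
  have f: "filter (\<lambda>j. j \<notin> insert i R) xs = filter (\<lambda>j. j \<noteq> i) ?xs"
    by (auto intro: filter_cong)
  show ?case
  proof (cases "i \<in> set ?xs")
    case False
    then have "filter (\<lambda>j. j \<noteq> i) ?xs = ?xs"
      by (intro filter_True) auto
    then show ?thesis using insert.IH f by simp
  next
    case True
    then obtain as bs where ab: "?xs = as @ i # bs"
      by (meson split_list)
    have d: "distinct (as @ i # bs)"
      using assms(3) ab by (metis distinct_filter)
    then have "filter (\<lambda>j. j \<noteq> i) as = as" "filter (\<lambda>j. j \<noteq> i) bs = bs"
      by (auto intro!: filter_True)
    then have "filter (\<lambda>j. j \<noteq> i) (as @ i # bs) = as @ bs"
      by simp
    moreover have "i < n"
      using True assms(4) by auto
    ultimately show ?thesis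
      using reach_remove[of as i bs n] insert.IH d unfolding f ab by simp
  qed
qed

lemma reach_mul_Vs:
  "reach (wt w) (ev w :: 'k::field ser) \<Longrightarrow> reach (wt (w @ map LV js)) (ev (w @ map LV js) :: 'k ser)"
proof (induction js arbitrary: w)
  case (Cons j js)
  have "reach (wt w + lam ^ j) (ev w \<star> V j :: 'k ser)"
    using Cons.prems reach_V by (rule reach_mul)
  then have "reach (wt (w @ [LV j])) (ev (w @ [LV j]) :: 'k ser)"
    by (simp add: ev_append mul_one_right tame_fin_supp)
  then show ?case
    using Cons.IH[of "w @ [LV j]"] by simp
qed simp

text \<open>The prefix of the first word has bracket 0 with the second word, and V_(j+3) has bracket
  0 with x_(j+1) and x_(j+2). Only the bracket of V_(j+3) with V_(j+5) is left; it supplies the last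
  three x-letters.\<close>

lemma br_full:
  "br (ev (xV [0..<j + 1] (j + 3))) (ev (xV [j + 1, j + 2] (j + 5)))
    = (smul (-1) (ev (xV [0..<j + 6] (j + 8))) :: 'k::field ser)"
proof -
  let ?r = "ev (map LX [0..<j + 1]) :: 'k ser" and ?G = "ev (xV [j + 1, j + 2] (j + 5)) :: 'k ser"
  let ?s = "ev (map LX [j + 1, j + 2]) :: 'k ser"
  have ev: "ev (xV zs k) = (ev (map LX zs) \<star> V k :: 'k ser)" for zs k
    by (simp add: xV_def ev_append mul_one_right tame_fin_supp)
  have 0: "br ?r ?G = 0"
    by (rule br_xword_low) auto
  have "br (V (j + 3)) (xg (j + 1)) = (0 :: 'k ser)" "br (V (j + 3)) (xg (j + 2)) = (0 :: 'k ser)"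
    by (simp_all only: br_V_x) (simp_all add: deriv_V_low ycode_def)
  then have "br (V (j + 3)) ?s = 0"
    using br_mul_right[OF homog_V homog_xy(1) tame_V tame_xy(1) tame_xy(1), of "j + 3" "j + 1" "j + 2", where 'a='k]
    by (simp add: mul_one_right tame_fin_supp)
  moreover have "br (V (j + 3)) (?s \<star> V (j + 5)) = br (V (j + 3)) ?s \<star> V (j + 5)
      + smul ((-1) ^ (Suc 0 * length (map LX [j + 1, j + 2]))) (?s \<star> br (V (j + 3)) (V (j + 5)))"
    by (intro br_mul_right homog_ev) auto
  moreover have "br (V (j + 3)) (V (j + 5)) = smul (-1) (ev (xV [j + 3, j + 4, j + 5] (j + 8)) :: 'k ser)"
    using br_V_V_Suc2[of "j + 3", where 'a='k] by (simp add: xV_def mul_one_right tame_fin_supp eval_nat_numeral)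
  ultimately have 1: "br (V (j + 3)) ?G = smul (-1) (?s \<star> ev (xV [j + 3, j + 4, j + 5] (j + 8)))"
    unfolding ev[of "[j + 1, j + 2]"] by (simp add: mul_smul_right)
  have "br (ev (xV [0..<j + 1] (j + 3))) ?G = ?r \<star> br (V (j + 3)) ?G
      + smul ((-1) ^ (Suc 0 * length (xV [j + 1, j + 2] (j + 5)))) (br ?r ?G \<star> V (j + 3))"
    unfolding ev[of "[0..<j + 1]"] by (intro br_mul_left[OF homog_ev homog_V homog_ev]) auto
  also have "\<dots> = smul (-1) (?r \<star> (?s \<star> ev (xV [j + 3, j + 4, j + 5] (j + 8))))"
    by (simp only: 0 1 mul_zero smul_zero mul_smul_right add_0_right)
  also have "?r \<star> (?s \<star> ev (xV [j + 3, j + 4, j + 5] (j + 8))) = ev (map LX [0..<j + 1] @ map LX [j + 1, j + 2]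
      @ xV [j + 3, j + 4, j + 5] (j + 8))"
    by (simp only: ev_append)
  also have "map LX [0..<j + 1] @ map LX [j + 1, j + 2] @ xV [j + 3, j + 4, j + 5] (j + 8) = xV [0..<j + 6] (j + 8)"
    by (simp add: xV_def eval_nat_numeral)
  finally show ?thesis .
qed

lemma reach_full: "reach (wt (xV [0..<5 * k + 1] (5 * k + 3))) (ev (xV [0..<5 * k + 1] (5 * k + 3)) :: 'k::field ser)"
proof (induction k)
  case 0
  have br: "br (V 0) (V 1) = (smul (-1) (ev (xV [0] 3)) :: 'k ser)"
    using br_V_V_Suc[of 0, where 'a='k] by (simp add: xV_def mul_one_right tame_fin_supp)
  have "wt (xV [0] 3) = lam ^ 0 + lam ^ 1"
    using lam_rec[of 0] by (simp add: xV_def)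
  then have "reach (wt (xV [0] 3)) (ev (xV [0] 3) :: 'k ser)"
    by (intro reach_br_smul[OF reach_V reach_V _ _ br]) auto
  then show ?case by simp
next
  case (Suc k)
  define j where "j = 5 * k"
  have r: "reach (wt (xV [0..<j + 1] (j + 3))) (ev (xV [0..<j + 1] (j + 3)) :: 'k ser)"
    using Suc by (simp add: j_def)
  have l5: "lam ^ (j + 5) = lam ^ (j + 3) + 2 * lam ^ (j + 2)" "lam ^ (j + 8) = lam ^ (j + 6) + 2 * lam ^ (j + 5)"
    "lam ^ (j + 6) = lam ^ (j + 4) + 2 * lam ^ (j + 3)" "lam ^ (j + 3) = lam ^ (j + 1) + 2 * lam ^ j"
    using lam_rec[of "j + 2"] lam_rec[of "j + 5"] lam_rec[of "j + 3"] lam_rec[of j]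
    by (simp_all add: eval_nat_numeral del: power_Suc)
  \<comment> \<open>The second argument of \<open>br_full\<close> is obtained by removing x_j from
    this bracket.\<close>
  have br: "br (V j) (V (j + 2)) = (smul (-1) (ev (xV ([] @ j # [j + 1, j + 2]) (j + 5))) :: 'k ser)"
    using br_V_V_Suc2[of j, where 'a='k] by (simp add: xV_def mul_one_right tame_fin_supp)
  have "wt (xV ([] @ j # [j + 1, j + 2]) (j + 5)) = lam ^ j + lam ^ (j + 2)"
    by (simp only: xV_def list.map append.simps wt_simps lwt.simps) (use l5 in linarith)
  then have "reach (wt (xV ([] @ j # [j + 1, j + 2]) (j + 5)))
      (ev (xV ([] @ j # [j + 1, j + 2]) (j + 5)) :: 'k ser)"
    by (intro reach_br_smul[OF reach_V reach_V _ _ br]) auto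
  then have "reach (wt (xV ([] @ [j + 1, j + 2]) (j + 5))) (ev (xV ([] @ [j + 1, j + 2]) (j + 5)) :: 'k ser)"
    by (rule reach_remove) auto
  then have "reach (wt (xV [j + 1, j + 2] (j + 5))) (ev (xV [j + 1, j + 2] (j + 5)) :: 'k ser)"
    by simp
  then have "reach (wt (xV [0..<j + 6] (j + 8))) (ev (xV [0..<j + 6] (j + 8)) :: 'k ser)"
  proof (rule reach_br_smul[OF r _ _ _ br_full])
    have "[0..<j + 6] = [0..<j + 1] @ [j + 1, j + 2, j + 3, j + 4, j + 5]"
      by (simp add: eval_nat_numeral)
    then show "wt (xV [0..<j + 6] (j + 8)) = wt (xV [0..<j + 1] (j + 3)) + wt (xV [j + 1, j + 2] (j + 5))"
      by (simp only: xV_def list.map map_append append.simps append_assoc wt_simps lwt.simps) (use l5 in linarith)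
  qed auto
  then show ?case
    by (simp add: j_def algebra_simps)
qed

end

section \<open>The growth function\<close>

context growth_rate
begin

text \<open>The sets \<open>A\<close> and \<open>B\<close> choose independently which x-letters and
  which further V-letters occur. Always keeping V_n allows unwanted x-letters to be removed.\<close>

definition lead_word :: "nat \<Rightarrow> nat set \<Rightarrow> nat set \<Rightarrow> letter list" where
  "lead_word n A B = xV (filter (\<lambda>i. i \<in> A) [0..<n - 2]) n @ map LV (filter (\<lambda>i. i \<in> B) [0..<n])"

lemma lead_word_reach:
  "reach (wt (lead_word (5 * k + 3) A B)) (ev (lead_word (5 * k + 3) A B) :: 'k::field ser)"
proof -
  let ?xs = "[0..<5 * k + 1]"
  have "filter (\<lambda>i. i \<notin> set ?xs - A) ?xs = filter (\<lambda>i. i \<in> A) ?xs"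
    by (intro filter_cong) auto
  moreover have "reach (wt (xV (filter (\<lambda>i. i \<notin> set ?xs - A) ?xs) (5 * k + 3)))
      (ev (xV (filter (\<lambda>i. i \<notin> set ?xs - A) ?xs) (5 * k + 3)) :: 'k ser)"
    by (rule reach_filter[OF _ reach_full]) auto
  moreover have "5 * k + 3 - 2 = 5 * k + 1"
    by simp
  ultimately show ?thesis
    unfolding lead_word_def by (intro reach_mul_Vs) (simp only:)
qed

text \<open>The x-letters only lower the weight, and the geometric sum over the further V-letters is
  at most \<open>2 * lam ^ n\<close> because \<open>lam - 1\<close> exceeds 1/2.\<close>

lemma lead_word_weight: "wt (lead_word n A B) \<le> 3 * lam ^ n"
proof -
  have "wt (map LX xs) \<le> 0" for xs
  proof (induction xs)
    case (Cons i xs)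
    then show ?case
      using lam_power_pos[of i] by (simp del: lam_power_pos)
  qed simp
  then have 1: "wt (xV (filter (\<lambda>i. i \<in> A) [0..<n - 2]) n) \<le> lam ^ n"
    by (simp add: xV_def)
  have "wt (map LV (filter (\<lambda>i. i \<in> B) [0..<n])) \<le> (\<Sum>i<n. lam ^ i)"
  proof (induction n)
    case (Suc n)
    then show ?case
      using lam_power_pos[of n] by (auto simp del: lam_power_pos)
  qed simp
  also have "\<dots> = (lam ^ n - 1) / (lam - 1)"
    using lam_gt by (intro geometric_sum) auto
  also have "\<dots> \<le> 2 * lam ^ n"
  proof -
    have "lam ^ n - 1 \<le> lam ^ n * 1"
      by simp
    also have "\<dots> \<le> lam ^ n * (2 * (lam - 1))"
      using lam_gt by (intro mult_left_mono) (auto intro: less_imp_le)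
    also have "\<dots> = 2 * lam ^ n * (lam - 1)"
      by simp
    finally have "lam ^ n - 1 \<le> 2 * lam ^ n * (lam - 1)" .
    then show ?thesis
      using lam_gt by (simp add: pos_divide_le_eq)
  qed
  finally show ?thesis
    using 1 by (simp add: lead_word_def)
qed

lemma lead_word_leads:
  assumes "A \<subseteq> {..<n - 2}" "B \<subseteq> {..<n}"
  shows "leads (xcode ` A \<union> ycode ` insert n B) (ev (lead_word n A B) :: 'k::field ser)"
proof -
  have "distinct (lead_word n A B)"
    by (auto simp: lead_word_def xV_def distinct_map inj_on_def)
  moreover have "set (lead_word n A B) = LX ` A \<union> LV ` insert n B"
    using assms by (auto simp: lead_word_def xV_def)
  then have "code ` set (lead_word n A B) = xcode ` A \<union> ycode ` insert n B"
    by (simp add: image_Un image_image)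
  ultimately show ?thesis
    using leads_ev by metis
qed

lemma Jwords_independent:
  assumes "9 * lam ^ (5 * k + 3) \<le> real n"
  obtains X :: "'k::field kan set" where "X \<subseteq> {u. \<exists>m. 1 \<le> m \<and> m \<le> n \<and> Jword m u}"
    "kan.independent X" "card X = 4 ^ (5 * k + 2)"
proof -
  define N where "N = 5 * k + 3"
  define D where "D = Pow {..<N - 2} \<times> Pow {..<N}"
  define S where "S = (\<lambda>(A, B). xcode ` A \<union> ycode ` insert N B)"
  have inj: "inj_on S D"
  \<comment> \<open>The condition \<open>i < N\<close> discards the code of V_N, which is present
    for every choice of \<open>B\<close>.\<close>
  proof (rule inj_on_inverseI[where g = "\<lambda>T. ({i. xcode i \<in> T}, {i. i < N \<and> ycode i \<in> T})"])
    fix p assume "p \<in> D"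
    then show "({i. xcode i \<in> S p}, {i. i < N \<and> ycode i \<in> S p}) = p"
      by (auto simp: D_def S_def image_iff)
  qed
  have "\<exists>c m. c \<noteq> 0 \<and> m \<le> n \<and> Jword m (kpair (smul c (ev (lead_word N A B)) :: 'k ser) 0)" for A B
  proof -
    obtain c m where cm: "c \<noteq> 0" "real m \<le> 3 * wt (lead_word N A B) - 2"
      "Jword m (kpair (smul c (ev (lead_word N A B)) :: 'k ser) 0)"
      using lead_word_reach[of k A B] unfolding reach_def N_def by blast
    \<comment> \<open>The constant 9 combines the factor 3 in \<open>reach\<close> with the factor 3
      in the weight bound.\<close>
    moreover have "3 * wt (lead_word N A B) - 2 \<le> real n"
      using lead_word_weight[of N A B] assms by (simp add: N_def)
    ultimately have "m \<le> n"
      by linarith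
    then show ?thesis
      using cm by blast
  qed
  then obtain c where c: "\<And>A B. c A B \<noteq> 0"
    "\<And>A B. \<exists>m\<le>n. Jword m (kpair (smul (c A B) (ev (lead_word N A B)) :: 'k ser) 0)"
    by metis
  define f where "f p = smul (c (fst p) (snd p)) (ev (lead_word N (fst p) (snd p)) :: 'k ser)" for p
  \<comment> \<open>The family is reindexed by its leading monomials, the form needed in
    \<open>leads_independent\<close>.\<close>
  define F where "F T = f (the_inv_into D S T)" for T
  have F: "F (S p) = f p" if "p \<in> D" for p
    using that inj by (simp add: F_def the_inv_into_f_f)
  have leads: "leads T (F T)" if T: "T \<in> S ` D" for T
  proof -
    obtain p where p: "p \<in> D" "T = S p"
      using T by blast
    have "leads (S p) (f p)"
      unfolding f_def using p(1) c(1)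
      by (intro leads_smul) (auto simp: S_def D_def simp del: image_insert intro!: lead_word_leads)
    then show ?thesis by (simp add: p F)
  qed
  let ?X = "(\<lambda>T. kpair (F T) 0) ` S ` D"
  have "?X \<subseteq> {u. \<exists>m. 1 \<le> m \<and> m \<le> n \<and> Jword m u}"
    using c(2) Jword_ge_1 by (fastforce simp: F f_def)
  moreover have "kan.independent ?X"
    using leads by (rule leads_independent(2))
  moreover have "card ?X = 4 ^ (5 * k + 2)"
  proof -
    have "card ?X = card D"
      using leads_independent(1)[of "S ` D" F] leads inj by (simp add: card_image)
    also have "\<dots> = 2 ^ (5 * k + 1) * 2 ^ (5 * k + 3)"
      by (simp add: D_def N_def card_cartesian_product card_Pow)
    also have "\<dots> = 2 ^ (2 * (5 * k + 2))"
      by (simp add: power_add[symmetric] del: power_Suc)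
    also have "\<dots> = 4 ^ (5 * k + 2)"
      by (simp only: power_mult) simp
    finally show ?thesis .
  qed
  ultimately show thesis by (rule that)
qed

lemma gamma_bounds:
  obtains d where "0 < d"
    "\<And>n N. lam ^ 2 * real n < d * lam ^ N \<Longrightarrow> gamma TYPE('k::field) n \<le> 2 * 4 ^ N"
    "\<And>n k. 9 * lam ^ (5 * k + 3) \<le> real n \<Longrightarrow> 4 ^ (5 * k + 2) \<le> gamma TYPE('k) n"
proof -
  let ?J = "\<lambda>n. {u :: 'k kan. \<exists>m. 1 \<le> m \<and> m \<le> n \<and> Jword m u}"
  obtain d where d: "0 < d" "\<And>n N. lam ^ 2 * real n < d * lam ^ N \<Longrightarrow> \<exists>W :: 'k kan set.
      finite W \<and> card W \<le> 2 * 4 ^ N \<and> ?J n \<subseteq> kan.span W"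
    by (rule Jwords_span) blast
  have upper: "gamma TYPE('k) n \<le> 2 * 4 ^ N" if N: "lam ^ 2 * real n < d * lam ^ N" for n N
  proof -
    obtain W :: "'k kan set" where "finite W" "card W \<le> 2 * 4 ^ N" "?J n \<subseteq> kan.span W"
      using d(2)[OF N] by blast
    then show ?thesis
      unfolding gamma_def using kan.dim_le_card[of "?J n" W] by linarith
  qed
  have lower: "4 ^ (5 * k + 2) \<le> gamma TYPE('k) n" if k: "9 * lam ^ (5 * k + 3) \<le> real n" for n k
  proof -
    obtain X :: "'k kan set" where X: "X \<subseteq> ?J n" "kan.independent X" "card X = 4 ^ (5 * k + 2)"
      using k by (rule Jwords_independent)
    \<comment> \<open>The upper bound is needed here too: an infinite basis would have
      \<open>card\<close> equal to 0, so the span must first be known to be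
      finite-dimensional.\<close>
    obtain N where "lam ^ 2 * real n / d < lam ^ N"
      using real_arch_pow[of lam] lam_gt by auto
    then have "lam ^ 2 * real n < d * lam ^ N"
      using d(1) by (simp add: field_simps)
    then obtain W :: "'k kan set" where W: "finite W" "?J n \<subseteq> kan.span W"
      using d(2) by blast
    obtain B where B: "B \<subseteq> ?J n" "kan.independent B" "?J n \<subseteq> kan.span B" "card B = kan.dim (?J n)"
      by (rule kan.basis_exists)
    have "finite B"
      using kan.independent_span_bound[OF W(1) B(2)] B(1) W(2) by blast
    then have "card X \<le> card B"
      using kan.independent_span_bound[of B X] X B(3) by blast
    then show ?thesis
      using X(3) B(4) by (simp add: gamma_def)
  qed
  show thesis
    using d(1) upper lower by (rule that)
qed

section \<open>Asymptotics: ln gamma(n) differs from a multiple of ln n by a bounded amount\<close>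

lemma ln_gamma_tendsto:
  "(\<lambda>n. ln (real (gamma TYPE('k::field) n)) / ln (real n)) \<longlonglongrightarrow> 2 * log lam 2"
proof -
  obtain d where d: "0 < d"
    and upper: "\<And>n N. lam ^ 2 * real n < d * lam ^ N \<Longrightarrow> gamma TYPE('k) n \<le> 2 * 4 ^ N"
    and lower: "\<And>n k. 9 * lam ^ (5 * k + 3) \<le> real n \<Longrightarrow> 4 ^ (5 * k + 2) \<le> gamma TYPE('k) n"
    by (rule gamma_bounds) blast
  define L where "L = 2 * log lam 2"
  have lam1: "1 < lam" and lam0: "0 < lam"
    using lam_gt by auto
  have L: "L = ln 4 / ln lam"
    using lam1 ln_realpow[of 2 2] by (simp add: L_def log_def)
  define C1 where "C1 = ln 2 + ln 4 * (\<bar>log lam (lam ^ 2 / d)\<bar> + 1)"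
  define C2 where "C2 = ln 4 * (log lam 9 + 6)"
  have low: "L * ln (real n) - C2 \<le> ln (real (gamma TYPE('k) n)) \<and> 0 < gamma TYPE('k) n"
    if n: "9 * lam ^ 3 \<le> real n" for n
  proof -
    have n0: "0 < real n"
      using n lam_power_pos[of 3] by linarith
    define t where "t = log lam (real n / 9)"
    have "3 \<le> t"
      using n n0 lam1 unfolding t_def by (subst le_log_iff) (auto simp: powr_numeral field_simps)
    \<comment> \<open>The largest \<open>k\<close> with \<open>5 * k + 3 \<le> t\<close>; it
      satisfies \<open>t - 6 < 5 * k + 2\<close>, which is where the 6 in \<open>C2\<close> comes
      from.\<close>
    define k where "k = nat \<lfloor>(t - 3) / 5\<rfloor>"
    have k: "real k \<le> (t - 3) / 5" "(t - 3) / 5 < real k + 1"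
      using \<open>3 \<le> t\<close> of_int_floor_le[of "(t - 3) / 5"] by (simp_all add: k_def del: of_int_floor_le)
    have "real (5 * k + 3) \<le> t"
      using k(1) by simp
    then have "lam powr real (5 * k + 3) \<le> lam powr t"
      using lam1 by (intro powr_mono) auto
    also have "\<dots> = real n / 9"
      using n0 lam1 by (simp add: t_def)
    finally have "9 * lam ^ (5 * k + 3) \<le> real n"
      using lam0 by (simp add: powr_realpow del: of_nat_add of_nat_mult)
    then have g: "4 ^ (5 * k + 2) \<le> gamma TYPE('k) n"
      by (rule lower)
    then have pos: "0 < gamma TYPE('k) n"
      by (metis gr0I less_le_trans not_less0 zero_less_numeral zero_less_power)
    have "t = log lam (real n) - log lam 9"
      using n0 lam1 by (simp add: t_def log_divide)
    then have "log lam (real n) - (log lam 9 + 6) \<le> real (5 * k + 2)"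
      using k(2) by simp
    then have "ln 4 * (log lam (real n) - (log lam 9 + 6)) \<le> ln 4 * real (5 * k + 2)"
      by (intro mult_left_mono) auto
    also have "\<dots> = ln (real (4 ^ (5 * k + 2)))"
      by (simp add: ln_realpow del: power_Suc)
    also have "\<dots> \<le> ln (real (gamma TYPE('k) n))"
      using g pos by (subst ln_le_cancel_iff) (auto simp del: of_nat_power)
    finally show ?thesis
      using pos by (simp add: L C2_def log_def algebra_simps)
  qed
  have up: "ln (real (gamma TYPE('k) n)) \<le> L * ln (real n) + C1" if n: "0 < n" "0 < gamma TYPE('k) n" for n
  proof -
    define t where "t = log lam (lam ^ 2 * real n / d)"
    \<comment> \<open>The absolute value keeps the argument of \<open>nat\<close> nonnegative, and
      adding 1 after rounding down makes the required inequality strict.\<close>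
    define N where "N = nat \<lfloor>\<bar>log lam (lam ^ 2 / d)\<bar> + log lam (real n)\<rfloor> + 1"
    have ln: "0 \<le> log lam (real n)"
      using n(1) lam1 by simp
    have N: "\<bar>log lam (lam ^ 2 / d)\<bar> + log lam (real n) < real N"
      "real N \<le> \<bar>log lam (lam ^ 2 / d)\<bar> + log lam (real n) + 1"
      using ln by (auto simp: N_def) linarith+
    have "t = log lam (lam ^ 2 / d) + log lam (real n)"
      using lam1 n d log_mult[of lam "lam ^ 2 / d" "real n"] by (simp add: t_def)
    then have "t < real N"
      using N(1) by linarith
    then have "lam powr t < lam powr real N"
      using lam1 by simp
    moreover have "lam powr t = lam ^ 2 * real n / d"
      unfolding t_def using lam1 n d by (intro powr_log_cancel) auto
    ultimately have "lam ^ 2 * real n < d * lam ^ N"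
      using d lam0 by (simp add: powr_realpow field_simps)
    then have "gamma TYPE('k) n \<le> 2 * 4 ^ N"
      by (rule upper)
    then have "real (gamma TYPE('k) n) \<le> real (2 * 4 ^ N)"
      by (rule of_nat_mono)
    then have "ln (real (gamma TYPE('k) n)) \<le> ln (real (2 * 4 ^ N))"
      using n(2) by (subst ln_le_cancel_iff) (auto simp del: of_nat_power of_nat_mult)
    also have "\<dots> = ln 2 + ln 4 * real N"
      by (simp add: ln_mult ln_realpow)
    also have "\<dots> \<le> ln 2 + ln 4 * (\<bar>log lam (lam ^ 2 / d)\<bar> + log lam (real n) + 1)"
      using N(2) by (intro add_left_mono mult_left_mono) auto
    finally show ?thesis
      by (simp add: L C1_def log_def algebra_simps)
  qed
  \<comment> \<open>The first condition gives the lower bound and \<open>0 < gamma\<close>, which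
    the upper bound presupposes; the second makes \<open>ln n\<close> positive for the
    division.\<close>
  have large: "eventually (\<lambda>n. 9 * lam ^ 3 \<le> real n \<and> 2 \<le> n) sequentially"
    using filterlim_at_top[THEN iffD1, OF filterlim_real_sequentially] eventually_ge_at_top
    by (intro eventually_conj) auto
  have zero: "(\<lambda>n. C / ln (real n)) \<longlonglongrightarrow> 0" for C
    by (rule tendsto_divide_0[OF tendsto_const])
      (rule filterlim_at_top_imp_at_infinity[OF filterlim_compose[OF ln_at_top filterlim_real_sequentially]])
  have "(\<lambda>n. ln (real (gamma TYPE('k) n)) / ln (real n)) \<longlonglongrightarrow> L"
  proof (rule tendsto_sandwich)
    show "eventually (\<lambda>n. L - C2 / ln (real n) \<le> ln (real (gamma TYPE('k) n)) / ln (real n)) sequentially"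
      using large
    proof eventually_elim
      case (elim n)
      then have pos: "0 < ln (real n)" by simp
      then have "L - C2 / ln (real n) = (L * ln (real n) - C2) / ln (real n)"
        by (simp add: diff_divide_distrib)
      then show ?case
        using low[of n] elim pos by (simp add: divide_right_mono)
    qed
    show "eventually (\<lambda>n. ln (real (gamma TYPE('k) n)) / ln (real n) \<le> L + C1 / ln (real n)) sequentially"
      using large
    proof eventually_elim
      case (elim n)
      then have pos: "0 < ln (real n)" by simp
      then have "L + C1 / ln (real n) = (L * ln (real n) + C1) / ln (real n)"
        by (simp add: add_divide_distrib)
      then show ?case
        using low[of n] up[of n] elim pos by (simp add: divide_right_mono)
    qed
    show "(\<lambda>n. L - C2 / ln (real n)) \<longlonglongrightarrow> L"
      using tendsto_diff[OF tendsto_const zero[of C2], of L] by simp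
    show "(\<lambda>n. L + C1 / ln (real n)) \<longlonglongrightarrow> L"
      using tendsto_add[OF tendsto_const zero[of C1], of L] by simp
  qed
  then show ?thesis by (simp add: L_def)
qed

end

theorem theorem12p10:
  fixes lam :: real
  assumes char: "(2::'k::field) \<noteq> 0"
    and lam: "lam ^ 3 - lam - 2 = 0"
  shows "GKdim TYPE('k) = ereal (2 * log lam 2) \<and> lower_GKdim TYPE('k) = ereal (2 * log lam 2)"
proof -
  interpret growth_rate lam
    using lam by unfold_locales
  have "(\<lambda>n. ereal (ln (real (gamma TYPE('k) n)) / ln (real n))) \<longlonglongrightarrow> ereal (2 * log lam 2)"
    using ln_gamma_tendsto by (simp add: tendsto_ereal)
  then show ?thesis
    unfolding GKdim_def lower_GKdim_def
    by (simp add: lim_imp_Limsup lim_imp_Liminf)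
qed

end
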